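(* Let $G$ be a graph with maximum degree $\Delta=5$. Then $G$ has a strong edge-coloring that uses (at most) $37$ colors.
   Context: Graphs are finite and simple. Two distinct edges are of distance at most two if either they share an endpoint or some endpoint of one is adjacent to some endpoint of the other. A strong edge-coloring of $G$ is an assignment of colors to all edges of $G$ such that no two distinct edges of distance at most two receive the same color. *)

theory Defs
  imports "Graph_Theory.Pair_Digraph"
begin

text \<open>
  Finite simple graphs are modelled by the locale \<^locale>\<open>pair_graph\<close>: a finite vertex set with a
  symmetric, irreflexive set of arcs. Every undirected edge corresponds to two opposite arcs;
  colours are assigned to the undirected edges, represented as two-element vertex sets.
\<close>

definition uedges :: "'a pair_pre_digraph \<Rightarrow> 'a set set" where
  "uedges G = {{u, v} | u v. (u, v) \<in> parcs G}"

definition degree :: "'a pair_pre_digraph \<Rightarrow> 'a \<Rightarrow> nat" where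
  "degree G v = card {e \<in> uedges G. v \<in> e}"

text \<open>The inserted 0 only matters for the graph without vertices.\<close>

definition max_degree :: "'a pair_pre_digraph \<Rightarrow> nat" where
  "max_degree G = Max (insert 0 (degree G ` pverts G))"

definition dist_le_two :: "'a pair_pre_digraph \<Rightarrow> 'a set \<Rightarrow> 'a set \<Rightarrow> bool" where
  "dist_le_two G e f \<longleftrightarrow>
     e \<inter> f \<noteq> {} \<or> (\<exists>u\<in>e. \<exists>v\<in>f. (u, v) \<in> parcs G)"

definition strong_edge_coloring :: "'a pair_pre_digraph \<Rightarrow> ('a set \<Rightarrow> 'c) \<Rightarrow> bool" where
  "strong_edge_coloring G c \<longleftrightarrow>
     (\<forall>e\<in>uedges G. \<forall>f\<in>uedges G. e \<noteq> f \<longrightarrow> dist_le_two G e f \<longrightarrow> c e \<noteq> c f)"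

lemma (in pair_graph) finite_uedges: "finite (uedges G)"
proof -
  have "uedges G = (\<lambda>(u, v). {u, v}) ` parcs G"
    by (force simp: uedges_def)
  then show ?thesis by simp
qed

lemma (in pair_graph) degree_eq_out_degree: "degree G v = out_degree (with_proj G) v"
proof -
  have "{e \<in> uedges G. v \<in> e} = (\<lambda>(u, w). {u, w}) ` out_arcs (with_proj G) v"
  proof (intro equalityI subsetI)
    fix e assume "e \<in> {e \<in> uedges G. v \<in> e}"
    then obtain u w where uw: "e = {u, w}" "(u, w) \<in> parcs G" "v = u \<or> v = w"
      by (auto simp: uedges_def)
    moreover have "(w, u) \<in> parcs G"
      using uw(2) pair_sym_arcs by (auto dest: arcs_symmetric)
    ultimately obtain x where "e = {v, x}" "(v, x) \<in> parcs G"
      by (auto simp: insert_commute)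
    then show "e \<in> (\<lambda>(u, w). {u, w}) ` out_arcs (with_proj G) v"
      by (force simp: out_arcs_def)
  qed (auto simp: uedges_def out_arcs_def)
  moreover have "inj_on (\<lambda>(u, w). {u, w}) (out_arcs (with_proj G) v)"
    by (auto simp: inj_on_def out_arcs_def doubleton_eq_iff)
  ultimately show ?thesis
    by (simp add: degree_def out_degree_def card_image)
qed

end

theory Submission
  imports Defs
begin

text \<open>
  Two edges must get different colours iff they are adjacent in the square of the line graph, in
  which every degree is at most 40. Fix a vertex \<open>v\<close> and colour greedily by decreasing distance to
  \<open>v\<close>: an edge away from \<open>v\<close> sees the five still uncoloured edges at a vertex one step closer to
  \<open>v\<close>, hence at most 35 colours. So a few edges around \<open>v\<close> can be kept until the end, and they
  succeed if they have small degree (an edge lying in \<open>k\<close> four-cycles has degree at most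
  \<open>40 - k\<close>) or if they see repeated colours. Repetitions are forced by precolouring a matching:
  since it uses at most one edge at each vertex, it costs distant edges only one of their spare
  colours, so that at most 36 of the 37 colours are seen.

  In a component that cannot be coloured, choosing the root and the matching suitably excludes in
  turn vertices of degree less than 5, triangles, pairs of vertices with four common neighbours,
  edges in two four-cycles, and four-cycles. Without four-cycles, the neighbours
  \<open>u\<^sub>1, \<dots>, u\<^sub>5\<close> of \<open>v\<close> have pairwise nonadjacent further neighbours \<open>w\<^sub>1, \<dots>, w\<^sub>5\<close>,
  and giving all edges \<open>u\<^sub>iw\<^sub>i\<close> the same colour saves four colours for each edge at \<open>v\<close>.
\<close>

section \<open>Greedy extension of a precolouring, and small cardinality facts\<close>

text \<open>Elements of \<open>A\<close> are coloured in order of increasing \<open>rk\<close>, ties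
  in either order, so only the counted ones can be coloured around \<open>e\<close> before its turn.
  On \<open>S\<close> colours are counted rather than elements: this is where a repetition in the
  precolouring pays.\<close>

lemma greedy_extension:
  fixes conf :: "'e \<Rightarrow> 'e \<Rightarrow> bool" and rk :: "'e \<Rightarrow> 'b::linorder" and \<sigma> :: "'e \<Rightarrow> nat"
  assumes "finite A" and "finite S"
    and conf_sym: "\<And>e f. conf e f \<Longrightarrow> conf f e"
    and conf_irrefl: "\<And>e. \<not> conf e e"
    and proper: "\<And>e f. e \<in> S \<Longrightarrow> f \<in> S \<Longrightarrow> conf e f \<Longrightarrow> \<sigma> e \<noteq> \<sigma> f"
    and range: "\<And>e. e \<in> S \<Longrightarrow> \<sigma> e < k"
    and bound: "\<And>e. e \<in> A \<Longrightarrow>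
      card {f \<in> A. conf e f \<and> rk f \<le> rk e} + card (\<sigma> ` {f \<in> S. conf e f}) < k"
    and disj: "A \<inter> S = {}"
  shows "\<exists>c. (\<forall>e\<in>S. c e = \<sigma> e) \<and> (\<forall>e\<in>A \<union> S. c e < k) \<and>
    (\<forall>e\<in>A \<union> S. \<forall>f\<in>A \<union> S. conf e f \<longrightarrow> c e \<noteq> c f)"
  using \<open>finite A\<close> bound disj
proof (induction A rule: finite_ranking_induct[where f = rk])
  case empty
  then show ?case using proper range by auto
next
  case (insert x A)
  show ?case
  proof (cases "x \<in> A")
    case True
    then show ?thesis using insert by (simp add: insert_absorb)
  next
    case False
    have sub: "card {f \<in> A. conf e f \<and> rk f \<le> rk e} \<le> card {f \<in> insert x A. conf e f \<and> rk f \<le> rk e}" for e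
      using \<open>finite A\<close> by (intro card_mono) auto
    have "card {f \<in> A. conf e f \<and> rk f \<le> rk e} + card (\<sigma> ` {f \<in> S. conf e f}) < k"
      if "e \<in> A" for e
      using insert(4)[of e] sub[of e] that by simp
    then obtain c where c: "\<forall>e\<in>S. c e = \<sigma> e" "\<forall>e\<in>A \<union> S. c e < k"
      "\<forall>e\<in>A \<union> S. \<forall>f\<in>A \<union> S. conf e f \<longrightarrow> c e \<noteq> c f"
      using insert(3,5) by blast
    define T where "T = c ` {f \<in> A. conf x f} \<union> \<sigma> ` {f \<in> S. conf x f}"
    have "{f \<in> insert x A. conf x f \<and> rk f \<le> rk x} = {f \<in> A. conf x f}"
      using insert(2) conf_irrefl by auto
    then have "card {f \<in> A. conf x f} + card (\<sigma> ` {f \<in> S. conf x f}) < k"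
      using insert(4)[of x] by simp
    moreover have "card T \<le> card {f \<in> A. conf x f} + card (\<sigma> ` {f \<in> S. conf x f})"
      unfolding T_def using card_image_le[of "{f \<in> A. conf x f}" c] \<open>finite A\<close>
      by (intro order_trans[OF card_Un_le]) auto
    moreover have "finite T" using \<open>finite A\<close> \<open>finite S\<close> by (simp add: T_def)
    ultimately have "\<not> {..<k} \<subseteq> T"
      using card_mono[of T "{..<k}"] by auto
    then obtain t where t: "t < k" "t \<notin> T" by auto
    define c' where "c' = c(x := t)"
    have xS: "x \<notin> S" using insert(5) by auto
    have new: "c f \<noteq> t" if "f \<in> A \<union> S" "conf x f" for f
      using t(2) that c(1) by (auto simp: T_def)
    have "c' e \<noteq> c' f" if "e \<in> insert x A \<union> S" "f \<in> insert x A \<union> S" "conf e f" for e f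
      using that new c(3) conf_irrefl conf_sym[of e f]
      by (cases "e = x"; cases "f = x") (auto simp: c'_def)
    moreover have "\<forall>e\<in>S. c' e = \<sigma> e" using c(1) xS by (auto simp: c'_def)
    moreover have "\<forall>e\<in>insert x A \<union> S. c' e < k" using c(2) t(1) by (auto simp: c'_def)
    ultimately show ?thesis by blast
  qed
qed

lemma ex_distinct_list:
  assumes "n \<le> card A"
  obtains xs where "distinct xs" "set xs \<subseteq> A" "length xs = n"
proof -
  obtain B where "B \<subseteq> A" "card B = n" "finite B"
    using assms by (rule obtain_subset_with_card_n)
  then show ?thesis using that finite_distinct_list[of B] distinct_card by metis
qed

lemma card_le_1_if_unique:
  assumes "\<And>x y. x \<in> A \<Longrightarrow> y \<in> A \<Longrightarrow> x = y"
  shows "card A \<le> 1"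
proof (cases "finite A")
  case True
  then show ?thesis using assms unfolding One_nat_def by (subst card_le_Suc0_iff_eq) blast+
qed simp

lemma common_of_two_pairs:
  assumes "card A \<le> 3" "finite A" "2 \<le> card (A \<inter> B)" "2 \<le> card (A \<inter> C)"
  shows "A \<inter> B \<inter> C \<noteq> {}"
proof
  assume "A \<inter> B \<inter> C = {}"
  then have "(A \<inter> B) \<inter> (A \<inter> C) = {}" by auto
  then have "card (A \<inter> B \<union> A \<inter> C) = card (A \<inter> B) + card (A \<inter> C)"
    using assms(2) by (intro card_Un_disjoint) auto
  moreover have "card (A \<inter> B \<union> A \<inter> C) \<le> card A" using assms(2) by (intro card_mono) auto
  ultimately show False using assms by linarith
qed

lemma two_elements:
  assumes "2 \<le> card A"
  obtains p where "p \<in> A" "p \<noteq> t"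
proof -
  have "\<not> A \<subseteq> {t}" using assms card_mono[of "{t}" A] by auto
  then show ?thesis using that by blast
qed

subsection \<open>Counting edges at distance at most two\<close>

text \<open>No vertex set is carried: every element of the type is a vertex, possibly isolated, and
  finiteness is asked of the arcs only.\<close>

locale deg5_graph =
  fixes N :: "'a \<Rightarrow> 'a set"
  assumes sym: "y \<in> N x \<Longrightarrow> x \<in> N y"
    and irrefl: "x \<notin> N x"
    and finite_arcs: "finite {(x, y). y \<in> N x}"
    and card_N: "card (N x) \<le> 5"
begin

definition E :: "'a set set" where
  "E = {{x, y} |x y. y \<in> N x}"

definition conf :: "'a set \<Rightarrow> 'a set \<Rightarrow> bool" where
  "conf e f \<longleftrightarrow> e \<noteq> f \<and> (e \<inter> f \<noteq> {} \<or> (\<exists>u\<in>e. \<exists>v\<in>f. v \<in> N u))"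

definition Nb :: "'a set \<Rightarrow> 'a set set" where
  "Nb e = {f \<in> E. conf e f}"

definition inc :: "'a \<Rightarrow> 'a set set" where
  "inc x = {e \<in> E. x \<in> e}"

text \<open>For \<open>P \<subseteq> N x\<close> these are the edges that continue from
  \<open>x\<close> through a vertex of \<open>P\<close>. Around an edge \<open>xy\<close> they make
  up the second layer.\<close>

definition branches :: "'a \<Rightarrow> 'a set \<Rightarrow> 'a set set" where
  "branches x P = (\<Union>p\<in>P. inc p - {{x, p}})"

lemma finite_N [simp]: "finite (N x)"
proof -
  have "N x = snd ` ({(x, y). y \<in> N x} \<inter> {x} \<times> UNIV)" by force
  then show ?thesis using finite_arcs by (metis finite_Int finite_imageI)
qed

lemma finite_E [simp]: "finite E"
proof -
  have "E = (\<lambda>(x, y). {x, y}) ` {(x, y). y \<in> N x}" by (force simp: E_def)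
  then show ?thesis using finite_arcs by simp
qed

lemma finite_Nb [simp]: "finite (Nb e)" and finite_inc [simp]: "finite (inc x)"
  by (simp_all add: Nb_def inc_def)

lemma edge_iff [simp]: "{x, y} \<in> E \<longleftrightarrow> y \<in> N x"
  using sym by (auto simp: E_def doubleton_eq_iff)

lemma edgeE:
  assumes "e \<in> E" "x \<in> e"
  obtains y where "e = {x, y}" "y \<in> N x"
  using assms sym by (auto simp: E_def insert_commute)

lemma conf_sym: "conf e f \<Longrightarrow> conf f e"
  using sym by (auto simp: conf_def)

lemma conf_irrefl [simp]: "\<not> conf e e"
  by (simp add: conf_def)

lemma inc_eq: "inc x = (\<lambda>y. {x, y}) ` N x"
  by (auto simp: inc_def elim: edgeE)

lemma inj_pair: "inj_on (\<lambda>y. {x, y}) A"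
  by (auto simp: inj_on_def doubleton_eq_iff)

lemma card_inc: "card (inc x) = card (N x)"
  by (simp add: inc_eq card_image inj_pair)

lemma pair_in_inc [simp]: "{x, y} \<in> inc x \<longleftrightarrow> y \<in> N x" "{x, y} \<in> inc y \<longleftrightarrow> y \<in> N x"
  by (auto simp: inc_def)

lemma finite_branches: "finite P \<Longrightarrow> finite (branches x P)"
  by (simp add: branches_def)

lemma card_branches:
  assumes "P \<subseteq> N x"
  shows "card (branches x P) \<le> 4 * card P"
proof -
  have fin: "finite P" using assms finite_N by (rule finite_subset)
  have "card (inc p - {{x, p}}) \<le> 4" if "p \<in> P" for p
  proof -
    have "{x, p} \<in> inc p" using that assms by auto
    then show ?thesis using card_inc[of p] card_N[of p] by simp
  qed
  then have "card (branches x P) \<le> (\<Sum>p\<in>P. 4)"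
    unfolding branches_def by (intro order_trans[OF card_UN_le[OF fin]] sum_mono)
  then show ?thesis by simp
qed

lemma Nb_subset:
  assumes "y \<in> N x"
  shows "Nb {x, y} \<subseteq> (inc x - {{x, y}}) \<union> (inc y - {{x, y}})
    \<union> branches x (N x - {y}) \<union> branches y (N y - {x})"
proof
  fix f assume "f \<in> Nb {x, y}"
  then have f: "f \<in> E" "f \<noteq> {x, y}" "{x, y} \<inter> f \<noteq> {} \<or> (\<exists>u\<in>{x, y}. \<exists>v\<in>f. v \<in> N u)"
    by (auto simp: Nb_def conf_def)
  show "f \<in> (inc x - {{x, y}}) \<union> (inc y - {{x, y}})
    \<union> branches x (N x - {y}) \<union> branches y (N y - {x})"
  proof (cases "x \<in> f \<or> y \<in> f")
    case True
    then show ?thesis using f by (auto simp: inc_def)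
  next
    case False
    then obtain u v where "u \<in> {x, y}" "v \<in> f" "v \<in> N u" using f by auto
    then show ?thesis using False f(1) by (auto simp: inc_def branches_def)
  qed
qed

lemma card_inc_minus: "y \<in> N x \<Longrightarrow> card (inc x - {{x, y}}) = card (N x) - 1"
  by (simp add: card_inc)

lemma card_inc_minus': "y \<in> N x \<Longrightarrow> card (inc y - {{x, y}}) = card (N y) - 1"
  by (simp add: card_inc)

text \<open>An element of \<open>Q\<close> is the edge opposite to \<open>xy\<close> in a
  four-cycle. It lies in the branches at both ends, so the count 4 + 4 + 16 + 16 = 40 takes it
  twice.\<close>

lemma card_Nb_cycles:
  assumes xy: "y \<in> N x"
    and Q: "\<And>q. q \<in> Q \<Longrightarrow> \<exists>a b. q = {a, b} \<and> a \<in> N x - {y} \<and> b \<in> N y - {x} \<and> b \<in> N a"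
  shows "card (Nb {x, y}) + card Q \<le> 40"
proof -
  let ?X = "branches x (N x - {y})" and ?Y = "branches y (N y - {x})"
  have yx: "x \<in> N y" using xy sym by blast
  have "Q \<subseteq> ?X \<inter> ?Y"
  proof
    fix q assume "q \<in> Q"
    then obtain a b where ab: "q = {a, b}" "a \<in> N x" "a \<noteq> y" "b \<in> N y" "b \<noteq> x" "b \<in> N a"
      using Q by blast
    have "{a, b} \<in> inc a - {{x, a}}" "{a, b} \<in> inc b - {{y, b}}"
      using ab by (auto simp: doubleton_eq_iff)
    then show "q \<in> ?X \<inter> ?Y"
      using ab unfolding branches_def by blast
  qed
  then have "card Q \<le> card (?X \<inter> ?Y)"
    by (intro card_mono) (auto simp: finite_branches)
  moreover have "card (?X \<union> ?Y) + card (?X \<inter> ?Y) = card ?X + card ?Y"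
    using card_Un_Int[of ?X ?Y] by (simp add: finite_branches)
  moreover have "card ?X \<le> 4 * (card (N x) - 1)" "card ?Y \<le> 4 * (card (N y) - 1)"
    using card_branches[of "N x - {y}" x] card_branches[of "N y - {x}" y] xy yx by auto
  moreover have "card (Nb {x, y}) \<le> (card (N x) - 1) + (card (N y) - 1) + card (?X \<union> ?Y)"
  proof -
    have "card (Nb {x, y}) \<le> card ((inc x - {{x, y}}) \<union> (inc y - {{x, y}}) \<union> (?X \<union> ?Y))"
      using Nb_subset[OF xy] by (intro card_mono) (auto simp: finite_branches)
    also have "\<dots> \<le> card (inc x - {{x, y}}) + card (inc y - {{x, y}}) + card (?X \<union> ?Y)"
      by (intro order_trans[OF card_Un_le] add_mono card_Un_le order_refl)
    finally show ?thesis using card_inc_minus[OF xy] card_inc_minus'[OF xy] by simp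
  qed
  ultimately show ?thesis using card_N[of x] card_N[of y] by linarith
qed

lemma card_Nb: "e \<in> E \<Longrightarrow> card (Nb e) \<le> 40"
  using card_Nb_cycles[of _ _ "{}"] by (auto simp: E_def)

text \<open>Each common neighbour \<open>z\<close> of \<open>v\<close> and \<open>x\<close> other
  than \<open>y\<close> closes the four-cycle \<open>v y x z\<close>, with \<open>xz\<close>
  opposite to \<open>vy\<close>. Leaving out \<open>z = y\<close> turns 40 into 41.\<close>

lemma card_Nb_common:
  assumes "y \<in> N v" "y \<in> N x" "v \<noteq> x"
  shows "card (Nb {v, y}) + card (N v \<inter> N x) \<le> 41"
proof -
  let ?Q = "(\<lambda>z. {x, z}) ` (N v \<inter> N x - {y})"
  have "card (Nb {v, y}) + card ?Q \<le> 40"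
  proof (rule card_Nb_cycles[OF assms(1)])
    fix q assume "q \<in> ?Q"
    then obtain z where "z \<in> N v" "z \<in> N x" "z \<noteq> y" "q = {z, x}" by auto
    then show "\<exists>a b. q = {a, b} \<and> a \<in> N v - {y} \<and> b \<in> N y - {v} \<and> b \<in> N a"
      using assms sym by blast
  qed
  moreover have "card ?Q = card (N v \<inter> N x) - 1"
    using assms by (simp add: card_image inj_pair)
  ultimately show ?thesis by linarith
qed

text \<open>For use when the edges at \<open>z\<close> are coloured after \<open>xy\<close>. The
  count 3 + 4 + 12 + 16 omits them from the start, so it does not depend on the degree of
  \<open>z\<close>.\<close>

lemma card_Nb_minus_inc:
  assumes xy: "y \<in> N x" and z: "z \<in> N x" "z \<noteq> y"
  shows "card (Nb {x, y} - inc z) \<le> 35"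
proof -
  have yx: "x \<in> N y" using xy sym by blast
  let ?A = "inc x - {{x, y}, {x, z}}" and ?B = "inc y - {{x, y}}"
  let ?X = "branches x (N x - {y, z})" and ?Y = "branches y (N y - {x})"
  have "Nb {x, y} - inc z \<subseteq> ?A \<union> ?B \<union> ?X \<union> ?Y"
  proof
    fix f assume f: "f \<in> Nb {x, y} - inc z"
    then have "f \<noteq> {x, z}" using z by auto
    moreover have "f \<in> branches x (N x - {y, z})" if "f \<in> branches x (N x - {y})"
      using that f unfolding branches_def by blast
    ultimately show "f \<in> ?A \<union> ?B \<union> ?X \<union> ?Y"
      using Nb_subset[OF xy] f by blast
  qed
  then have "card (Nb {x, y} - inc z) \<le> card (?A \<union> ?B \<union> ?X \<union> ?Y)"
    by (intro card_mono) (auto simp: finite_branches)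
  also have "\<dots> \<le> card ?A + card ?B + card ?X + card ?Y"
    by (intro order_trans[OF card_Un_le] add_mono card_Un_le order_refl)
  also have "\<dots> \<le> 3 + 4 + 12 + 16"
  proof (intro add_mono)
    have "{x, y} \<noteq> {x, z}" using z by (auto simp: doubleton_eq_iff)
    then show "card ?A \<le> 3"
      using card_inc[of x] card_N[of x] xy z by (simp add: card_Diff_subset)
    show "card ?B \<le> 4" using card_inc_minus'[OF xy] card_N[of y] by simp
    have "card (N x - {y, z}) \<le> 3" using card_N[of x] xy z by (simp add: card_Diff_subset)
    then show "card ?X \<le> 12" using card_branches[of "N x - {y, z}" x] by auto
    show "card ?Y \<le> 16"
      using card_branches[of "N y - {x}" y] card_N[of y] yx by auto
  qed
  finally show ?thesis by simp
qed

lemma card_Nb_low_degree: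
  assumes xy: "y \<in> N x" and "card (N x) \<le> 4"
  shows "card (Nb {x, y}) \<le> 36"
proof -
  have yx: "x \<in> N y" using xy sym by blast
  let ?A = "inc x - {{x, y}}" and ?B = "inc y - {{x, y}}"
  let ?X = "branches x (N x - {y})" and ?Y = "branches y (N y - {x})"
  have "card (Nb {x, y}) \<le> card (?A \<union> ?B \<union> ?X \<union> ?Y)"
    using Nb_subset[OF xy] by (intro card_mono) (auto simp: finite_branches)
  also have "\<dots> \<le> card ?A + card ?B + card ?X + card ?Y"
    by (intro order_trans[OF card_Un_le] add_mono card_Un_le order_refl)
  also have "\<dots> \<le> 3 + 4 + 12 + 16"
    using card_branches[of "N y - {x}" y] card_N[of y] yx
      card_branches[of "N x - {y}" x] xy assms(2) card_inc_minus[OF xy] card_inc_minus'[OF xy]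
    by (intro add_mono) auto
  finally show ?thesis by simp
qed

subsection \<open>Greedy colouring towards a root\<close>

definition adj_rel :: "('a \<times> 'a) set" where
  "adj_rel = {(x, y). y \<in> N x}"

definition component :: "'a \<Rightarrow> 'a set set" where
  "component v = {e \<in> E. \<exists>x\<in>e. (v, x) \<in> adj_rel\<^sup>*}"

definition good :: "'a \<Rightarrow> bool" where
  "good v \<longleftrightarrow> (\<exists>c :: 'a set \<Rightarrow> nat. (\<forall>e\<in>component v. c e < 37) \<and>
     (\<forall>e\<in>component v. \<forall>f\<in>component v. conf e f \<longrightarrow> c e \<noteq> c f))"

lemma reach_step: "(v, x) \<in> adj_rel\<^sup>* \<Longrightarrow> y \<in> N x \<Longrightarrow> (v, y) \<in> adj_rel\<^sup>*"
  by (auto simp: adj_rel_def intro: rtrancl_into_rtrancl)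

lemma component_iff: "{x, y} \<in> component v \<longleftrightarrow> y \<in> N x \<and> (v, x) \<in> adj_rel\<^sup>*"
  using reach_step sym by (auto simp: component_def)

lemma component_conf:
  assumes "e \<in> component v" "f \<in> E" "conf e f"
  shows "f \<in> component v"
proof -
  have e: "e \<in> E" and f: "f \<in> E" using assms by (auto simp: component_def)
  have reach: "(v, x) \<in> adj_rel\<^sup>*" if "x \<in> e" for x
    using assms(1) that e component_iff by (metis edgeE)
  have "\<exists>x\<in>f. (v, x) \<in> adj_rel\<^sup>*"
    using assms(3) reach reach_step unfolding conf_def by blast
  then show ?thesis using f by (auto simp: component_def)
qed

lemma component_adj:
  assumes "y \<in> N x"
  shows "component x = component y"
proof -
  have "(x, y) \<in> adj_rel" "(y, x) \<in> adj_rel" using assms sym by (auto simp: adj_rel_def)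
  then have "(x, z) \<in> adj_rel\<^sup>* \<longleftrightarrow> (y, z) \<in> adj_rel\<^sup>*" for z
    by (meson converse_rtrancl_into_rtrancl)
  then show ?thesis by (simp add: component_def)
qed

text \<open>Goodness is a property of the component, so an uncolourable component may be rooted at
  any of its vertices.\<close>

lemma good_adj: "y \<in> N x \<Longrightarrow> good y \<Longrightarrow> good x"
  using component_adj by (simp add: good_def)

text \<open>Graph distance from \<open>v\<close>, meaningful only for reachable
  \<open>x\<close>.\<close>

definition depth :: "'a \<Rightarrow> 'a \<Rightarrow> nat" where
  "depth v x = (LEAST n. (v, x) \<in> adj_rel ^^ n)"

lemma depth_parent:
  assumes "(v, x) \<in> adj_rel\<^sup>*" "x \<noteq> v"
  obtains z where "z \<in> N x" "depth v z < depth v x"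
proof -
  have "\<exists>n. (v, x) \<in> adj_rel ^^ n" using assms(1) rtrancl_imp_relpow by blast
  then have "(v, x) \<in> adj_rel ^^ depth v x" unfolding depth_def by (rule LeastI_ex)
  moreover have "depth v x \<noteq> 0" using calculation assms(2) by (metis relpow_0_E)
  ultimately obtain n z where "depth v x = Suc n" "(v, z) \<in> adj_rel ^^ n" "(z, x) \<in> adj_rel"
    by (metis not0_implies_Suc relpow_Suc_E)
  moreover from this have "depth v z \<le> n" unfolding depth_def by (intro Least_le)
  ultimately show ?thesis using that[of z] sym by (auto simp: adj_rel_def)
qed

definition edge_depth :: "'a \<Rightarrow> 'a set \<Rightarrow> nat" where
  "edge_depth v e = Min (depth v ` e)"

text \<open>The endpoint of \<open>e\<close> nearer to \<open>v\<close> has a neighbour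
  \<open>z\<close> nearer still. By decreasing depth the edges at \<open>z\<close> come after
  \<open>e\<close>, which leaves at most 35 neighbours ahead of it.\<close>

lemma edge_parent:
  assumes "e \<in> component v" "v \<notin> e"
  obtains z where "card (Nb e - inc z) \<le> 35" "\<And>f. f \<in> inc z \<Longrightarrow> edge_depth v f < edge_depth v e"
proof -
  have "e \<in> E" using assms by (auto simp: component_def)
  then obtain x y where e: "e = {x, y}" "y \<in> N x" "depth v x \<le> depth v y"
    unfolding E_def using sym by (smt (verit) insert_commute mem_Collect_eq nat_le_linear)
  have "(v, x) \<in> adj_rel\<^sup>*" using assms(1) e component_iff by simp
  then obtain z where z: "z \<in> N x" "depth v z < depth v x"
    using depth_parent assms(2) e(1) by blast
  have "z \<noteq> y" using z e by auto
  moreover have "edge_depth v f < edge_depth v e" if f: "f \<in> inc z" for f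
  proof -
    have "edge_depth v f \<le> depth v z"
      using f unfolding edge_depth_def inc_eq by (auto intro!: Min_le)
    then show ?thesis using z e by (simp add: edge_depth_def)
  qed
  ultimately show ?thesis using that[of z] card_Nb_minus_inc[OF e(2) z(1)] e(1) by auto
qed

text \<open>The order is by decreasing \<open>edge_depth\<close>. Away from \<open>v\<close> the
  vertex \<open>z\<close> leaves 35 edges, and a matching \<open>S\<close> adds at most one edge at
  \<open>z\<close>, so at most 36 colours are seen. At \<open>v\<close> itself the gap must come
  from the uncoloured set \<open>F\<close>, as \<open>root\<close> demands.\<close>

lemma colour_distant:
  fixes \<sigma> :: "'a set \<Rightarrow> nat"
  assumes "S \<subseteq> E" "S \<inter> F = {}"
    and matching: "\<And>e f. e \<in> S \<Longrightarrow> f \<in> S \<Longrightarrow> e \<noteq> f \<Longrightarrow> e \<inter> f = {}"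
    and proper: "\<And>e f. e \<in> S \<Longrightarrow> f \<in> S \<Longrightarrow> conf e f \<Longrightarrow> \<sigma> e \<noteq> \<sigma> f"
    and range: "\<And>e. e \<in> S \<Longrightarrow> \<sigma> e < 37"
    and root: "\<And>e. e \<in> inc v \<Longrightarrow> e \<notin> F \<Longrightarrow> e \<notin> S \<Longrightarrow> card (Nb e - F) \<le> 36"
  shows "\<exists>c :: 'a set \<Rightarrow> nat. (\<forall>e\<in>S. c e = \<sigma> e) \<and> (\<forall>e\<in>(component v - F) \<union> S. c e < 37) \<and>
    (\<forall>e\<in>(component v - F) \<union> S. \<forall>f\<in>(component v - F) \<union> S. conf e f \<longrightarrow> c e \<noteq> c f)"
proof -
  let ?A = "component v - F - S" and ?rk = "\<lambda>e. - int (edge_depth v e)"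
  have fin: "finite ?A" "finite S"
    using finite_E assms(1) by (auto simp: component_def intro: finite_subset)
  have "\<exists>c. (\<forall>e\<in>S. c e = \<sigma> e) \<and> (\<forall>e\<in>?A \<union> S. c e < 37) \<and>
    (\<forall>e\<in>?A \<union> S. \<forall>f\<in>?A \<union> S. conf e f \<longrightarrow> c e \<noteq> c f)"
  proof (rule greedy_extension[where rk = ?rk, OF fin conf_sym conf_irrefl proper range])
    fix e assume e: "e \<in> ?A"
    let ?B = "{f \<in> ?A. conf e f \<and> ?rk f \<le> ?rk e}" and ?C = "{f \<in> S. conf e f}"
    have "card (?B \<union> ?C) \<le> 36"
    proof (cases "v \<in> e")
      case True
      then have "card (Nb e - F) \<le> 36" using e root by (auto simp: inc_def component_def)
      moreover have "?B \<union> ?C \<subseteq> Nb e - F" using assms(1,2) by (auto simp: Nb_def component_def)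
      ultimately show ?thesis by (meson card_mono finite_Diff finite_Nb le_trans)
    next
      case False
      then obtain z where z: "card (Nb e - inc z) \<le> 35"
          "\<And>f. f \<in> inc z \<Longrightarrow> edge_depth v f < edge_depth v e"
        using e edge_parent by (metis DiffD1)
      have "card (S \<inter> inc z) \<le> 1"
        using fin matching unfolding One_nat_def inc_def by (subst card_le_Suc0_iff_eq) blast+
      moreover have "?B \<union> ?C \<subseteq> (Nb e - inc z) \<union> (S \<inter> inc z)"
        using z(2) assms(1) by (fastforce simp: Nb_def component_def)
      then have "card (?B \<union> ?C) \<le> card ((Nb e - inc z) \<union> (S \<inter> inc z))"
        using fin by (intro card_mono) auto
      ultimately show ?thesis
        using z(1) card_Un_le[of "Nb e - inc z" "S \<inter> inc z"] by linarith
    qed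
    moreover have "finite ?B" "finite ?C"
      by (rule finite_subset[OF _ fin(1)], blast, rule finite_subset[OF _ fin(2)], blast)
    then have "card (?B \<union> ?C) = card ?B + card ?C"
      by (intro card_Un_disjoint) auto
    moreover have "card (\<sigma> ` ?C) \<le> card ?C" using fin by (intro card_image_le) auto
    ultimately show "card ?B + card (\<sigma> ` ?C) < 37" by linarith
  qed auto
  moreover have "?A \<union> S = (component v - F) \<union> S" by auto
  ultimately show ?thesis by metis
qed

text \<open>
  The edges in \<open>F\<close> are coloured last, and among them \<open>F ! 0\<close> comes last. Each of them sees the whole
  precoloured matching \<open>S\<close>, whose colouring repeats colours \<open>s\<close> times.
\<close>

lemma good_root:
  fixes \<sigma> :: "'a set \<Rightarrow> nat"
  assumes F: "set F \<subseteq> E" "distinct F" "\<And>e f. e \<in> set F \<Longrightarrow> f \<in> set F \<Longrightarrow> e \<noteq> f \<Longrightarrow> conf e f"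
    and S: "S \<subseteq> E" "S \<inter> set F = {}" "\<And>e f. e \<in> S \<Longrightarrow> f \<in> S \<Longrightarrow> e \<noteq> f \<Longrightarrow> e \<inter> f = {}"
    and proper: "\<And>e f. e \<in> S \<Longrightarrow> f \<in> S \<Longrightarrow> conf e f \<Longrightarrow> \<sigma> e \<noteq> \<sigma> f"
    and range: "\<And>e. e \<in> S \<Longrightarrow> \<sigma> e < 37"
    and seen: "\<And>e f. e \<in> S \<Longrightarrow> f \<in> set F \<Longrightarrow> conf f e"
    and saving: "card (\<sigma> ` S) + s \<le> card S"
    and root: "\<And>e. e \<in> inc v \<Longrightarrow> e \<notin> set F \<Longrightarrow> e \<notin> S \<Longrightarrow> card (Nb e - set F) \<le> 36"
    and last: "\<And>j. j < length F \<Longrightarrow> card (Nb (F ! j)) \<le> 36 + s + j"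
  shows "good v"
proof -
  let ?B = "(component v - set F) \<union> S"
  have "\<exists>c :: 'a set \<Rightarrow> nat. (\<forall>e\<in>S. c e = \<sigma> e) \<and> (\<forall>e\<in>?B. c e < 37) \<and>
    (\<forall>e\<in>?B. \<forall>f\<in>?B. conf e f \<longrightarrow> c e \<noteq> c f)"
    by (rule colour_distant) (fact S proper range root)+
  then obtain c :: "'a set \<Rightarrow> nat" where c: "\<forall>e\<in>S. c e = \<sigma> e" "\<forall>e\<in>?B. c e < 37"
    "\<forall>e\<in>?B. \<forall>f\<in>?B. conf e f \<longrightarrow> c e \<noteq> c f" by blast
  have fin: "finite ?B" "finite S"
    using finite_E S(1) by (auto simp: component_def intro: finite_subset)
  have "bij_betw ((!) F) {..<length F} (set F)" using F(2) by (rule bij_betw_nth) auto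
  then obtain pos where pos: "bij_betw pos (set F) {..<length F}" "\<And>e. e \<in> set F \<Longrightarrow> F ! pos e = e"
    by (metis bij_betw_inv_into bij_betw_inv_into_right)
  let ?rk = "\<lambda>e. - int (pos e)"
  have "\<exists>c'. (\<forall>e\<in>?B. c' e = c e) \<and> (\<forall>e\<in>set F \<union> ?B. c' e < 37) \<and>
    (\<forall>e\<in>set F \<union> ?B. \<forall>f\<in>set F \<union> ?B. conf e f \<longrightarrow> c' e \<noteq> c' f)"
  proof (rule greedy_extension[where rk = ?rk, OF finite_set fin(1) conf_sym conf_irrefl])
    fix e assume e: "e \<in> set F"
    let ?L = "{f \<in> set F. conf e f \<and> ?rk f \<le> ?rk e}" and ?T = "{f \<in> ?B. conf e f}"
    have j: "pos e < length F" using pos(1) e by (auto simp: bij_betw_def)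
    have "card ?L \<le> card (pos ` ?L)"
      using pos(1) by (subst card_image) (auto simp: bij_betw_def intro: inj_on_subset)
    also have "\<dots> \<le> card {pos e<..<length F}"
    proof (intro card_mono subsetI)
      fix i assume "i \<in> pos ` ?L"
      then obtain f where f: "i = pos f" "f \<in> set F" "conf e f" "pos e \<le> pos f" by auto
      moreover have "pos f < length F" using pos(1) f(2) by (auto simp: bij_betw_def)
      moreover have "pos e \<noteq> pos f" using pos(2) e f by (metis conf_irrefl)
      ultimately show "i \<in> {pos e<..<length F}" by auto
    qed simp
    finally have L: "card ?L + pos e + 1 \<le> length F" using j by simp
    have "set F - {e} \<subseteq> Nb e" using F(1,3) e by (auto simp: Nb_def)
    then have "Nb e \<inter> set F = set F - {e}" by (auto simp: Nb_def)
    moreover have "card (set F - {e}) = length F - 1"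
      using e F(2) by (simp add: distinct_card)
    moreover have "card (Nb e) = card (Nb e \<inter> set F) + card (Nb e - set F)"
      by (simp add: card_Int_Diff)
    \<comment> \<open>With \<open>j = pos e\<close>, at most
      \<open>36 + s + j - (length F - 1)\<close> neighbours lie outside \<open>F\<close>.
      Subtracting the \<open>s\<close> repetitions and adding the at most
      \<open>length F - 1 - j\<close> edges of \<open>F\<close> already coloured leaves 36.\<close>
    ultimately have "card (Nb e - set F) + length F \<le> 37 + s + pos e"
      using last[OF j] pos(2)[OF e] j by simp
    moreover have "card (c ` ?T) + s \<le> card (Nb e - set F)"
    proof -
      have ST: "S \<subseteq> ?T" using seen e by auto
      have finT: "finite ?T" using fin by auto
      have "card (c ` ?T) \<le> card (c ` S \<union> c ` (?T - S))"
        using fin by (intro card_mono) auto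
      also have "\<dots> \<le> card (c ` S) + card (?T - S)"
        using finT by (intro order_trans[OF card_Un_le] add_mono card_image_le) auto
      also have "c ` S = \<sigma> ` S" using c(1) by auto
      also have "card (?T - S) = card ?T - card S"
        using ST fin(2) by (intro card_Diff_subset) auto
      finally have "card (c ` ?T) + s \<le> card ?T"
        using saving card_mono[OF finT ST] by linarith
      moreover have "?T \<subseteq> Nb e - set F" using S(1,2) by (auto simp: Nb_def component_def)
      then have "card ?T \<le> card (Nb e - set F)" by (intro card_mono) auto
      ultimately show ?thesis by linarith
    qed
    ultimately show "card ?L + card (c ` ?T) < 37" using L by linarith
  qed (use c S(2) in auto)
  then obtain c' where "\<forall>e\<in>set F \<union> ?B. c' e < (37::nat)"
    "\<forall>e\<in>set F \<union> ?B. \<forall>f\<in>set F \<union> ?B. conf e f \<longrightarrow> c' e \<noteq> c' f" by blast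
  moreover have "component v \<subseteq> set F \<union> ?B" by auto
  ultimately show ?thesis unfolding good_def by blast
qed

section \<open>Gluing components, and four late edges around a root\<close>

lemma ex_colouring:
  assumes "\<And>v. good v"
  shows "\<exists>c :: 'a set \<Rightarrow> nat. (\<forall>e\<in>E. c e < 37) \<and> (\<forall>e\<in>E. \<forall>f\<in>E. conf e f \<longrightarrow> c e \<noteq> c f)"
proof -
  obtain C :: "'a \<Rightarrow> 'a set \<Rightarrow> nat" where C: "\<And>v e. e \<in> component v \<Longrightarrow> C v e < 37"
    "\<And>v e f. e \<in> component v \<Longrightarrow> f \<in> component v \<Longrightarrow> conf e f \<Longrightarrow> C v e \<noteq> C v f"
    using assms unfolding good_def by metis
  define r where "r e = (SOME v. e \<in> component v)" for e
  have r: "e \<in> component (r e)" if "e \<in> E" for e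
  proof -
    have "\<exists>v. e \<in> component v" using that by (auto simp: E_def component_def)
    then show ?thesis unfolding r_def by (rule someI_ex)
  qed
  \<comment> \<open>Conflicting edges lie in exactly the same components, so \<open>SOME\<close> is
    applied to the same predicate.\<close>
  have "r e = r f" if "e \<in> E" "f \<in> E" "conf e f" for e f
    using component_conf that conf_sym unfolding r_def by metis
  then show ?thesis using C r by (intro exI[of _ "\<lambda>e. C (r e) e"]) metis
qed

lemma conf_pair:
  assumes "y \<in> N x" "b \<in> N a"
  shows "conf {x, y} {a, b} \<longleftrightarrow> {x, y} \<noteq> {a, b} \<and>
    (x = a \<or> x = b \<or> y = a \<or> y = b \<or> a \<in> N x \<or> b \<in> N x \<or> a \<in> N y \<or> b \<in> N y)"
  by (auto simp: conf_def)

text \<open>If the remaining edges at the root are near all four late edges, each of them sees at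
  most 40 - 4 = 36 edges before its turn.\<close>

lemma good_root4:
  fixes \<sigma> :: "'a set \<Rightarrow> nat"
  assumes F: "{f0, f1, f2, f3} \<subseteq> E" "distinct [f0, f1, f2, f3]"
      "\<And>e f. e \<in> {f0, f1, f2, f3} \<Longrightarrow> f \<in> {f0, f1, f2, f3} \<Longrightarrow> e \<noteq> f \<Longrightarrow> conf e f"
    and S: "S \<subseteq> E" "S \<inter> {f0, f1, f2, f3} = {}" "\<And>e f. e \<in> S \<Longrightarrow> f \<in> S \<Longrightarrow> e \<noteq> f \<Longrightarrow> e \<inter> f = {}"
    and proper: "\<And>e f. e \<in> S \<Longrightarrow> f \<in> S \<Longrightarrow> conf e f \<Longrightarrow> \<sigma> e \<noteq> \<sigma> f"
    and range: "\<And>e. e \<in> S \<Longrightarrow> \<sigma> e < 37"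
    and seen: "\<And>e f. e \<in> S \<Longrightarrow> f \<in> {f0, f1, f2, f3} \<Longrightarrow> conf f e"
    and saving: "card (\<sigma> ` S) + s \<le> card S"
    and root: "\<And>e f. e \<in> inc v \<Longrightarrow> e \<notin> {f0, f1, f2, f3} \<Longrightarrow> e \<notin> S \<Longrightarrow> f \<in> {f0, f1, f2, f3} \<Longrightarrow> conf e f"
    and last: "card (Nb f0) \<le> 36 + s" "card (Nb f1) \<le> 37 + s" "card (Nb f2) \<le> 38 + s" "card (Nb f3) \<le> 39 + s"
  shows "good v"
proof (rule good_root[where F = "[f0, f1, f2, f3]" and S = S and \<sigma> = \<sigma> and s = s])
  fix e assume e: "e \<in> inc v" "e \<notin> set [f0, f1, f2, f3]" "e \<notin> S"
  have "set [f0, f1, f2, f3] \<subseteq> Nb e" using F(1) root[OF e(1) _ e(3)] e(2) by (auto simp: Nb_def)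
  moreover have "card (set [f0, f1, f2, f3]) = 4" using distinct_card[OF F(2)] by simp
  moreover have "card (Nb e) \<le> 40" using e by (intro card_Nb) (auto simp: inc_def)
  ultimately show "card (Nb e - set [f0, f1, f2, f3]) \<le> 36"
    by (simp add: card_Diff_subset)
next
  fix j assume "j < length [f0, f1, f2, f3]"
  then have "j \<in> {0, 1, 2, 3}" by auto
  then show "card (Nb ([f0, f1, f2, f3] ! j)) \<le> 36 + s + j" using last by auto
qed (use assms in \<open>simp_all\<close>)

text \<open>Four edges at \<open>v\<close> come last, and edges from \<open>u\<close> to
  \<open>w u\<close> are precoloured. Each of these is near every edge at \<open>v\<close>, and
  without triangles at \<open>v\<close> they form a matching. Two of them may share a colour when
  none of the adjacencies in \<open>indep\<close> joins them.\<close>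

lemma good_star:
  fixes \<tau> :: "'a \<Rightarrow> nat"
  assumes no_tri: "\<And>y z. y \<in> N v \<Longrightarrow> z \<in> N v \<Longrightarrow> z \<notin> N y"
    and y: "distinct [y0, y1, y2, y3]" "{y0, y1, y2, y3} \<subseteq> N v"
    and U: "U \<subseteq> N v" "\<And>u. u \<in> U \<Longrightarrow> w u \<in> N u \<and> w u \<noteq> v"
    and w_inj: "\<And>u u'. u \<in> U \<Longrightarrow> u' \<in> U \<Longrightarrow> u \<noteq> u' \<Longrightarrow> w u \<noteq> w u'"
    and indep: "\<And>u u'. u \<in> U \<Longrightarrow> u' \<in> U \<Longrightarrow> u \<noteq> u' \<Longrightarrow> \<tau> u = \<tau> u' \<Longrightarrow> w u \<notin> N u' \<and> w u \<notin> N (w u')"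
    and range: "\<And>u. u \<in> U \<Longrightarrow> \<tau> u < 37"
    and saving: "card (\<tau> ` U) + s \<le> card U"
    and last: "card (Nb {v, y0}) \<le> 36 + s" "card (Nb {v, y1}) \<le> 37 + s" "card (Nb {v, y2}) \<le> 38 + s" "card (Nb {v, y3}) \<le> 39 + s"
  shows "good v"
proof -
  let ?g = "\<lambda>u. {u, w u}"
  let ?\<sigma> = "\<lambda>e. \<tau> (inv_into U ?g e)"
  have vU: "v \<noteq> u" if "u \<in> U" for u using that U(1) irrefl by auto
  have disj: "?g u \<inter> ?g u' = {}" if "u \<in> U" "u' \<in> U" "u \<noteq> u'" for u u'
    using that w_inj[OF that] U no_tri[of u u'] no_tri[of u' u] by auto
  then have inj: "inj_on ?g U" by (force intro!: inj_onI)
  then have \<sigma>: "?\<sigma> (?g u) = \<tau> u" if "u \<in> U" for u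
    using inv_into_f_f[OF inj that] by simp
  show ?thesis
  proof (rule good_root4[where S = "?g ` U" and \<sigma> = ?\<sigma> and s = s])
    show "card (?\<sigma> ` ?g ` U) + s \<le> card (?g ` U)"
    proof -
      have "?\<sigma> ` ?g ` U = \<tau> ` U" using \<sigma> by (simp add: image_image cong: image_cong_simp)
      then show ?thesis using saving card_image[OF inj] by simp
    qed
    show "e \<inter> f = {}" if ef: "e \<in> ?g ` U" "f \<in> ?g ` U" "e \<noteq> f" for e f
    proof -
      obtain u u' where u: "e = ?g u" "f = ?g u'" "u \<in> U" "u' \<in> U" using ef by auto
      moreover have "u \<noteq> u'" using u ef(3) by auto
      ultimately show ?thesis using disj[of u u'] by simp
    qed
    show "?\<sigma> e \<noteq> ?\<sigma> f" if ef: "e \<in> ?g ` U" "f \<in> ?g ` U" "conf e f" for e f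
    proof -
      obtain u u' where u: "e = ?g u" "f = ?g u'" "u \<in> U" "u' \<in> U" using ef by auto
      have ne: "u \<noteq> u'" using u ef(3) by auto
      have "\<not> conf e f" if "\<tau> u = \<tau> u'"
        using indep[OF u(3,4) ne that] indep[OF u(4,3) ne[symmetric] that[symmetric]]
          disj[OF u(3,4) ne] no_tri[of u u'] no_tri[of u' u] U u sym
        by (auto simp: conf_pair u(1,2))
      then show ?thesis using ef(3) \<sigma> u by metis
    qed
    show "?\<sigma> e < 37" if "e \<in> ?g ` U" for e using that \<sigma> range by auto
    show "?g ` U \<inter> {{v, y0}, {v, y1}, {v, y2}, {v, y3}} = {}"
      using U vU by (auto simp: doubleton_eq_iff)
    show "conf f e" if ef: "e \<in> ?g ` U" "f \<in> {{v, y0}, {v, y1}, {v, y2}, {v, y3}}" for e f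
    proof -
      obtain u where u: "e = ?g u" "u \<in> U" using ef by auto
      obtain y where "f = {v, y}" using ef by auto
      moreover have "v \<notin> e" using u U vU by auto
      ultimately show ?thesis using u U by (auto simp: conf_def)
    qed
  qed (use y U last in \<open>auto simp: conf_def doubleton_eq_iff inc_eq\<close>)
qed

lemma good_star_plain:
  assumes no_tri: "\<And>y z. y \<in> N v \<Longrightarrow> z \<in> N v \<Longrightarrow> z \<notin> N y"
    and y: "distinct [y0, y1, y2, y3]" "{y0, y1, y2, y3} \<subseteq> N v"
    and last: "card (Nb {v, y0}) \<le> 36" "card (Nb {v, y1}) \<le> 37" "card (Nb {v, y2}) \<le> 38" "card (Nb {v, y3}) \<le> 39"
  shows "good v"
  by (rule good_star[where U = "{}" and s = 0, OF assms(1-3)]) (use last in auto)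

section \<open>Degrees, triangles and common neighbours in a bad component\<close>

lemma bad_adj: "\<not> good v \<Longrightarrow> y \<in> N v \<Longrightarrow> \<not> good y"
  using good_adj by blast

text \<open>With a root of degree at most 4 the plain greedy order succeeds, since edges at the root
  have at most 36 neighbours.\<close>

lemma bad_degree:
  assumes "\<not> good v"
  shows "card (N v) = 5"
proof (rule ccontr)
  assume "card (N v) \<noteq> 5"
  then have "card (N v) \<le> 4" using card_N[of v] by linarith
  then have "good v"
    by (intro good_root[where F = "[]" and S = "{}" and s = 0]) (auto simp: inc_eq card_Nb_low_degree)
  then show False using assms by blast
qed

text \<open>The edges \<open>xw\<close> and \<open>yw\<close> are already counted next to
  \<open>x\<close> and \<open>y\<close>, and the other three edges at \<open>w\<close> are counted
  once instead of twice: 4 + 4 + 12 + 12 + 3.\<close>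

lemma card_Nb_triangle:
  assumes xy: "y \<in> N x" and w: "w \<in> N x" "w \<in> N y"
  shows "card (Nb {x, y}) \<le> 35"
proof -
  have yx: "x \<in> N y" using xy sym by blast
  have ne: "w \<noteq> x" "w \<noteq> y" "x \<noteq> y" using w xy irrefl by auto
  let ?A = "inc x - {{x, y}}" and ?B = "inc y - {{x, y}}"
  let ?X = "branches x (N x - {y, w})" and ?Y = "branches y (N y - {x, w})"
  let ?W = "inc w - {{x, w}, {y, w}}"
  have "Nb {x, y} \<subseteq> ?A \<union> ?B \<union> ?X \<union> ?Y \<union> ?W"
  proof
    fix f assume f: "f \<in> Nb {x, y}"
    then have "f \<noteq> {x, y}" by (auto simp: Nb_def)
    moreover have "f \<in> branches x (N x - {y, w}) \<or> f \<in> ?W \<or> f = {y, w}" if "f \<in> branches x (N x - {y})"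
      using that unfolding branches_def by blast
    moreover have "f \<in> branches y (N y - {x, w}) \<or> f \<in> ?W \<or> f = {x, w}" if "f \<in> branches y (N y - {x})"
      using that unfolding branches_def by blast
    moreover have "{y, w} \<in> ?B" "{x, w} \<in> ?A" using w ne by (auto simp: doubleton_eq_iff)
    ultimately show "f \<in> ?A \<union> ?B \<union> ?X \<union> ?Y \<union> ?W"
      using Nb_subset[OF xy] f by blast
  qed
  then have "card (Nb {x, y}) \<le> card (?A \<union> ?B \<union> ?X \<union> ?Y \<union> ?W)"
    by (intro card_mono) (auto simp: finite_branches)
  also have "\<dots> \<le> card ?A + card ?B + card ?X + card ?Y + card ?W"
    by (intro order_trans[OF card_Un_le] add_mono card_Un_le order_refl)
  also have "\<dots> \<le> 4 + 4 + 12 + 12 + 3"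
  proof (intro add_mono)
    show "card ?A \<le> 4" using card_inc_minus[OF xy] card_N[of x] by simp
    show "card ?B \<le> 4" using card_inc_minus'[OF xy] card_N[of y] by simp
    have "card (N x - {y, w}) \<le> 3" "card (N y - {x, w}) \<le> 3"
      using card_N[of x] card_N[of y] xy yx w ne by (simp_all add: card_Diff_subset)
    then show "card ?X \<le> 12" "card ?Y \<le> 12"
      using card_branches[of "N x - {y, w}" x] card_branches[of "N y - {x, w}" y] by auto
    have "{x, w} \<noteq> {y, w}" using ne by (auto simp: doubleton_eq_iff)
    then show "card ?W \<le> 3"
      using card_inc[of w] card_N[of w] w by (simp add: card_Diff_subset)
  qed
  finally show ?thesis by simp
qed

text \<open>The edge \<open>u1u2\<close> would be counted in the branches through \<open>u1\<close>
  and through \<open>u2\<close>; \<open>?W\<close> drops it from the first, saving one of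
  40.\<close>

lemma card_Nb_beside_triangle:
  assumes y: "y \<in> N v" and u: "u1 \<in> N v" "u2 \<in> N v" "u2 \<in> N u1" "u1 \<noteq> y" "u2 \<noteq> y"
  shows "card (Nb {v, y}) \<le> 39"
proof -
  have yv: "v \<in> N y" using y sym by blast
  have ne: "u1 \<noteq> u2" "v \<noteq> u1" "v \<noteq> u2" "v \<noteq> y" using u y irrefl by auto
  let ?A = "inc v - {{v, y}}" and ?B = "inc y - {{v, y}}"
  let ?X = "branches v (N v - {y, u1, u2})" and ?Y = "branches y (N y - {v})"
  let ?W = "inc u1 - {{v, u1}, {u1, u2}}" and ?W' = "inc u2 - {{v, u2}}"
  have "Nb {v, y} \<subseteq> ?A \<union> ?B \<union> ?X \<union> ?Y \<union> ?W \<union> ?W'"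
  proof
    fix f assume f: "f \<in> Nb {v, y}"
    then have "f \<noteq> {v, y}" by (auto simp: Nb_def)
    moreover have "f \<in> ?X \<or> f \<in> ?W \<or> f = {u1, u2} \<or> f \<in> ?W'" if "f \<in> branches v (N v - {y})"
      using that unfolding branches_def by blast
    moreover have "{u1, u2} \<in> ?W'" using u(3) ne by (simp add: doubleton_eq_iff)
    moreover have "f \<in> inc v - {{v, y}} \<or> f \<in> ?B \<or> f \<in> branches v (N v - {y}) \<or> f \<in> ?Y"
      using Nb_subset[OF y] f by blast
    ultimately show "f \<in> ?A \<union> ?B \<union> ?X \<union> ?Y \<union> ?W \<union> ?W'"
      unfolding Un_iff by metis
  qed
  then have "card (Nb {v, y}) \<le> card (?A \<union> ?B \<union> ?X \<union> ?Y \<union> ?W \<union> ?W')"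
    by (intro card_mono) (auto simp: finite_branches)
  also have "\<dots> \<le> card ?A + card ?B + card ?X + card ?Y + card ?W + card ?W'"
    by (intro order_trans[OF card_Un_le] add_mono card_Un_le order_refl)
  also have "\<dots> \<le> 4 + 4 + 8 + 16 + 3 + 4"
  proof (intro add_mono)
    show "card ?A \<le> 4" using card_inc_minus[OF y] card_N[of v] by simp
    show "card ?B \<le> 4" using card_inc_minus'[OF y] card_N[of y] by simp
    have "card (N v - {y, u1, u2}) \<le> 2"
      using card_N[of v] y u ne by (simp add: card_Diff_subset)
    then show "card ?X \<le> 8" using card_branches[of "N v - {y, u1, u2}" v] by auto
    show "card ?Y \<le> 16" using card_branches[of "N y - {v}" y] card_N[of y] yv by auto
    have "{v, u1} \<noteq> {u1, u2}" using ne by (auto simp: doubleton_eq_iff)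
    then show "card ?W \<le> 3"
      using card_inc[of u1] card_N[of u1] u by (simp add: card_Diff_subset)
    show "card ?W' \<le> 4" using card_inc_minus'[OF u(2)] card_N[of u2] by simp
  qed
  finally show ?thesis by simp
qed

text \<open>The triangle edges have degree at most 35 and a further edge \<open>vy\<close> at most
  39. They are pairwise near and near every other edge at \<open>v\<close>, so they can come last
  without any precolouring.\<close>

lemma bad_no_triangle:
  assumes bad: "\<not> good v" and u: "u1 \<in> N v" "u2 \<in> N v"
  shows "u2 \<notin> N u1"
proof
  assume adj: "u2 \<in> N u1"
  have u': "u1 \<in> N u2" "v \<in> N u1" "v \<in> N u2" using adj u sym by auto
  have "card {u1, u2} \<le> 2" by (simp add: card_insert_if)
  then have "\<not> N v \<subseteq> {u1, u2}"
    using bad_degree[OF bad] card_mono[of "{u1, u2}" "N v"] by auto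
  then obtain y where y: "y \<in> N v" "y \<noteq> u1" "y \<noteq> u2" by auto
  have ne: "u1 \<noteq> u2" "v \<noteq> u1" "v \<noteq> u2" "v \<noteq> y" using u y adj irrefl by auto
  have "good v"
  proof (rule good_root4[where S = "{}" and s = 0])
    show "card (Nb {v, u1}) \<le> 36 + 0" "card (Nb {v, u2}) \<le> 37 + 0" "card (Nb {u1, u2}) \<le> 38 + 0"
      using card_Nb_triangle[of u1 v u2] card_Nb_triangle[of u2 v u1] card_Nb_triangle[of u2 u1 v] u u' adj
      by auto
    show "card (Nb {v, y}) \<le> 39 + 0" using card_Nb_beside_triangle[OF y(1) u adj] y by auto
  qed (use u u' adj y ne in \<open>auto simp: conf_def doubleton_eq_iff inc_eq\<close>)
  then show False using bad by blast
qed

text \<open>Besides the cycles through \<open>x\<close>, the edge \<open>vy\<close> lies on the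
  four-cycle \<open>v y z y'\<close>. Its opposite edge \<open>y'z\<close> avoids \<open>x\<close>,
  so it is one more saving.\<close>

lemma card_Nb_common_extra:
  assumes y: "y \<in> N v" "y \<in> N x" and y': "y' \<in> N v" "y' \<in> N x" and "y \<noteq> y'" "v \<noteq> x"
    and z: "z \<in> N y" "z \<in> N y'" "z \<noteq> v" "z \<noteq> x"
  shows "card (Nb {v, y}) + card (N v \<inter> N x) \<le> 40"
proof -
  let ?Q = "insert {y', z} ((\<lambda>t. {x, t}) ` (N v \<inter> N x - {y}))"
  have "card (Nb {v, y}) + card ?Q \<le> 40"
  proof (rule card_Nb_cycles[OF y(1)])
    fix q assume "q \<in> ?Q"
    then consider "q = {y', z}" | t where "t \<in> N v" "t \<in> N x" "t \<noteq> y" "q = {t, x}" by auto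
    then show "\<exists>a b. q = {a, b} \<and> a \<in> N v - {y} \<and> b \<in> N y - {v} \<and> b \<in> N a"
    proof cases
      case 1
      then show ?thesis using assms by (intro exI[of _ y'] exI[of _ z]) auto
    next
      case 2
      then show ?thesis using assms sym by (intro exI[of _ t] exI[of _ x]) auto
    qed
  qed
  moreover have "{y', z} \<notin> (\<lambda>t. {x, t}) ` (N v \<inter> N x - {y})"
    using y' z irrefl by (auto simp: doubleton_eq_iff)
  moreover have "card ((\<lambda>t. {x, t}) ` (N v \<inter> N x - {y})) = card (N v \<inter> N x) - 1"
    using y by (simp add: card_image inj_pair)
  moreover have "card (N v \<inter> N x) > 0"
    using y by (auto simp: card_gt_0_iff)
  ultimately show ?thesis by simp
qed

lemma bad_common_le_3:
  assumes bad: "\<not> good v" and "v \<noteq> x"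
  shows "card (N v \<inter> N x) \<le> 3"
proof (rule ccontr)
  assume "\<not> card (N v \<inter> N x) \<le> 3"
  then have four: "card (N v \<inter> N x) \<ge> 4" by simp
  note no_tri = bad_no_triangle[OF bad]
  have le37: "card (Nb {v, y}) \<le> 37" if "y \<in> N v \<inter> N x" for y
    using card_Nb_common[of y v x] that four \<open>v \<noteq> x\<close> by auto
  have disj: "z \<notin> N y'" if z: "y \<in> N v \<inter> N x" "y' \<in> N v \<inter> N x" "y \<noteq> y'" "z \<in> N y" "z \<noteq> v" "z \<noteq> x" for y y' z
  proof
    assume "z \<in> N y'"
    then have le36: "card (Nb {v, y}) \<le> 36"
      using card_Nb_common_extra[of y v x y' z] z four \<open>v \<noteq> x\<close> by auto
    have "3 \<le> card (N v \<inter> N x - {y})" using four z(1) by simp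
    then obtain ys where ys: "distinct ys" "set ys \<subseteq> N v \<inter> N x - {y}" "length ys = 3"
      by (rule ex_distinct_list)
    from ys(3) obtain y1 y2 y3 where "ys = [y1, y2, y3]"
      by (auto simp: length_Suc_conv eval_nat_numeral)
    then have "good v"
      using ys z(1) le36 le37[of y1] le37[of y2] le37[of y3]
      by (intro good_star_plain[of v y y1 y2 y3] no_tri) auto
    then show False using bad by blast
  qed
  obtain ys where ys: "distinct ys" "set ys \<subseteq> N v \<inter> N x" "length ys = 4"
    using four by (rule ex_distinct_list)
  from ys(3) obtain y0 y1 y2 y3 where y: "ys = [y0, y1, y2, y3]"
    by (auto simp: length_Suc_conv eval_nat_numeral)
  have "\<exists>z\<in>N y. z \<noteq> v \<and> z \<noteq> x" if "y \<in> N v" for y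
  proof -
    have "card (N y) = 5" using bad_degree bad_adj[OF bad that] by blast
    moreover have "card {v, x} \<le> 2" by (simp add: card_insert_if)
    ultimately have "\<not> N y \<subseteq> {v, x}" using card_mono[of "{v, x}" "N y"] by auto
    then show ?thesis by blast
  qed
  then obtain w where w: "w y \<in> N y" "w y \<noteq> v" "w y \<noteq> x" if "y \<in> N v" for y by metis
  \<comment> \<open>The vertex \<open>w y0\<close> lies in the same bad component, where triangles
    are excluded.\<close>
  have "w y1 \<notin> N (w y0) \<or> w y2 \<notin> N (w y0) \<or> w y2 \<notin> N (w y1)"
    using bad_no_triangle[of "w y0" "w y1" "w y2"] bad_adj[OF bad_adj[OF bad, of y0], of "w y0"] w[of y0] ys y
    by auto
  then obtain y y' where yy: "y \<in> {y0, y1, y2}" "y' \<in> {y0, y1, y2}" "y \<noteq> y'" "w y' \<notin> N (w y)"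
    using ys(1) y by auto
  have sub: "{y0, y1, y2, y3} \<subseteq> N v \<inter> N x" using ys(2) y by simp
  then have yy': "y \<in> N v \<inter> N x" "y' \<in> N v \<inter> N x" using yy(1,2) by blast+
  have wy: "w y \<in> N y" "w y \<noteq> v" "w y \<noteq> x" "w y' \<in> N y'" "w y' \<noteq> v" "w y' \<noteq> x"
    using w yy' by blast+
  have cross: "w y \<notin> N y'" "w y' \<notin> N y"
    using disj[OF yy' yy(3) wy(1-3)] disj[OF yy'(2,1) yy(3)[symmetric] wy(4-6)] .
  have nonadj: "w y \<notin> N (w y')" "w y \<noteq> w y'"
    using yy(4) cross(1) wy(4) sym by auto
  have "good v"
  proof (rule good_star[where U = "{y, y'}" and w = w and \<tau> = "\<lambda>_. 0" and s = 1, OF no_tri])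
    show "distinct [y0, y1, y2, y3]" using ys(1) y by simp
    show "{y0, y1, y2, y3} \<subseteq> N v" using sub by blast
    show "w u \<noteq> w u'" if "u \<in> {y, y'}" "u' \<in> {y, y'}" "u \<noteq> u'" for u u'
      using that nonadj(2) by auto
    show "w u \<notin> N u' \<and> w u \<notin> N (w u')" if "u \<in> {y, y'}" "u' \<in> {y, y'}" "u \<noteq> u'" for u u'
      using that nonadj(1) yy(4) cross by auto
    show "card (Nb {v, y0}) \<le> 36 + 1" "card (Nb {v, y1}) \<le> 37 + 1"
      "card (Nb {v, y2}) \<le> 38 + 1" "card (Nb {v, y3}) \<le> 39 + 1"
      using le37[of y0] le37[of y1] le37[of y2] le37[of y3] sub by auto
  qed (use yy(3) yy' wy in auto)
  then show False using bad by blast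
qed

text \<open>
  Otherwise \<open>N v - N x\<close> and \<open>N x - N v\<close> are completely joined. If \<open>v\<close> and \<open>x\<close> have two common
  neighbours, then two vertices of \<open>N v - N x\<close> have four. If they have three, then \<open>v\<close>, \<open>b1\<close> and \<open>b2\<close>
  are common neighbours of \<open>a1\<close> and \<open>a2\<close>, so many edges at the root \<open>a1\<close> lie in several four-cycles,
  and repeating a colour on one edge at \<open>v\<close> and one edge at \<open>b1\<close> is enough.
\<close>

lemma bad_nonadjacent_pair:
  assumes bad: "\<not> good v" and "v \<noteq> x" and two: "2 \<le> card (N v \<inter> N x)"
  obtains a b where "a \<in> N v - N x" "b \<in> N x - N v" "b \<notin> N a"
proof (rule ccontr)
  assume "\<not> thesis"
  with that have complete: "b \<in> N a" if "a \<in> N v - N x" "b \<in> N x - N v" for a b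
    using that by blast
  obtain ys where ys: "distinct ys" "set ys \<subseteq> N v \<inter> N x" "length ys = 2"
    using two by (rule ex_distinct_list)
  from ys(3) obtain y1 y2 where "ys = [y1, y2]"
    by (auto simp: length_Suc_conv eval_nat_numeral)
  with ys have y: "y1 \<noteq> y2" "{y1, y2} \<subseteq> N v \<inter> N x" by auto
  have bad_y: "\<not> good y1" "\<not> good y2" using bad_adj[OF bad] y by auto
  have bad_x: "\<not> good x" using bad_adj[OF bad_y(1)] y sym by blast
  have xv: "x \<notin> N v" "v \<notin> N x" using bad_no_triangle[OF bad, of y1 x] y sym by blast+
  have cards: "card (N v - N x) = 5 - card (N v \<inter> N x)" "card (N x - N v) = 5 - card (N v \<inter> N x)"
    using bad_degree[OF bad] bad_degree[OF bad_x] card_Int_Diff[of "N v" "N x"] card_Int_Diff[of "N x" "N v"]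
    by (simp_all add: Int_commute)
  have le3: "card (N v \<inter> N x) \<le> 3" using bad_common_le_3[OF bad \<open>v \<noteq> x\<close>] .
  then have "2 \<le> card (N v - N x)" using cards by simp
  then obtain as where as: "distinct as" "set as \<subseteq> N v - N x" "length as = 2"
    by (rule ex_distinct_list)
  from as(3) obtain a1 a2 where "as = [a1, a2]"
    by (auto simp: length_Suc_conv eval_nat_numeral)
  with as have a: "a1 \<noteq> a2" "a1 \<in> N v - N x" "a2 \<in> N v - N x" by auto
  have bad_a: "\<not> good a1" "\<not> good a2" using bad_adj[OF bad] a by auto
  have "insert v (N x - N v) \<subseteq> N a1 \<inter> N a2" using complete a sym by blast
  then have "card (insert v (N x - N v)) \<le> card (N a1 \<inter> N a2)" by (intro card_mono) auto
  then have common_a: "card (N x - N v) + 1 \<le> card (N a1 \<inter> N a2)" using xv by simp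
  moreover have "card (N a1 \<inter> N a2) \<le> 3" using bad_common_le_3[OF bad_a(1) a(1)] .
  \<comment> \<open>For \<open>c\<close> common neighbours of \<open>v\<close> and \<open>x\<close>
    the two bounds give \<open>(5 - c) + 1 \<le> 3\<close>.\<close>
  ultimately have three: "card (N v \<inter> N x) = 3" using cards le3 by linarith
  then have "2 \<le> card (N x - N v)" using cards by simp
  then obtain bs where bs: "distinct bs" "set bs \<subseteq> N x - N v" "length bs = 2"
    by (rule ex_distinct_list)
  from bs(3) obtain b1 b2 where "bs = [b1, b2]"
    by (auto simp: length_Suc_conv eval_nat_numeral)
  with bs have b: "b1 \<noteq> b2" "b1 \<in> N x - N v" "b2 \<in> N x - N v" by auto
  have bad_b: "\<not> good b1" using bad_adj[OF bad_x, of b1] b by blast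
  have ab: "b1 \<in> N a1" "b1 \<in> N a2" "b2 \<in> N a1" "b2 \<in> N a2" using complete a b by blast+
  have A: "N v - N x = {a1, a2}"
    using a cards three by (intro card_seteq[symmetric]) auto
  have "card {x, a1, a2} \<le> 3" by (simp add: card_insert_if)
  then have "2 \<le> card (N b1 - {x, a1, a2})"
    using bad_degree[OF bad_b] diff_card_le_card_Diff[of "{x, a1, a2}" "N b1"] by simp
  then obtain rs where rs: "distinct rs" "set rs \<subseteq> N b1 - {x, a1, a2}" "length rs = 2"
    by (rule ex_distinct_list)
  from rs(3) obtain r1 r2 where "rs = [r1, r2]"
    by (auto simp: length_Suc_conv eval_nat_numeral)
  with rs have r: "r1 \<noteq> r2" "{r1, r2} \<subseteq> N b1 - {x, a1, a2}" by auto
  \<comment> \<open>The edges \<open>vy\<close> and \<open>b1r\<close> are to share a colour. If no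
    choice worked, \<open>y1\<close> and \<open>y2\<close> would have the four common neighbours
    \<open>v\<close>, \<open>x\<close>, \<open>r1\<close>, \<open>r2\<close>.\<close>
  have "\<exists>y\<in>{y1, y2}. \<exists>r\<in>{r1, r2}. r \<notin> N y"
  proof (rule ccontr)
    assume "\<not> ?thesis"
    then have "{v, x, r1, r2} \<subseteq> N y1 \<inter> N y2" using y sym by auto
    then have "card {v, x, r1, r2} \<le> card (N y1 \<inter> N y2)" by (intro card_mono) auto
    moreover have "v \<notin> {r1, r2}" using r b sym by blast
    then have "card {v, x, r1, r2} = 4" using r \<open>v \<noteq> x\<close> by (auto simp: card_insert_if)
    ultimately show False using bad_common_le_3[OF bad_y(1) y(1)] by simp
  qed
  then obtain y r where yr: "y \<in> N v" "y \<in> N x" "r \<in> N b1" "r \<notin> {x, a1, a2}" "r \<notin> N y"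
    using y r by blast
  have vb: "v \<notin> N b1" "b1 \<notin> N v" using b sym by auto
  have yb: "y \<notin> N b1" "b1 \<notin> N y" using bad_no_triangle[OF bad_x, of y b1] yr b sym by auto
  have vr: "r \<notin> N v"
  proof
    assume "r \<in> N v"
    then have "r \<in> N x" using A yr by auto
    then show False using bad_no_triangle[OF bad_x, of r b1] b yr sym by auto
  qed
  have yr': "y \<notin> N r" using yr sym by blast
  have "card {v, b1, b2} \<le> 3" by (simp add: card_insert_if)
  then have "\<not> N a1 \<subseteq> {v, b1, b2}"
    using bad_degree[OF bad_a(1)] card_mono[of "{v, b1, b2}" "N a1"] by auto
  then obtain p where p: "p \<in> N a1" "p \<noteq> v" "p \<noteq> b1" "p \<noteq> b2" by auto
  have va: "v \<in> N a1" "v \<in> N a2" using a sym by auto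
  have common3: "3 \<le> card (N a1 \<inter> N a2)" using common_a cards three by simp
  have c0: "card (Nb {a1, b1}) \<le> 37"
  proof -
    have "x \<in> N b1" "x \<in> N b2" "x \<noteq> a1" "x \<noteq> a2" using a b xv sym by blast+
    then show ?thesis
      using card_Nb_common_extra[of b1 a1 a2 b2 x] ab a(1) b(1) common3 by linarith
  qed
  have c1: "card (Nb {a1, b2}) \<le> 38"
    using card_Nb_common[of b2 a1 a2] ab a(1) common3 by linarith
  have c2: "card (Nb {a1, v}) \<le> 38"
    using card_Nb_common[of v a1 a2] va a(1) common3 by linarith
  have c3: "card (Nb {a1, p}) \<le> 40" using p card_Nb by simp
  \<comment> \<open>One saving allows degrees 37, 38, 39, 40 for the last four edges, to
    \<open>b1\<close>, \<open>b2\<close>, \<open>v\<close> and \<open>p\<close>.\<close>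
  have "good a1"
  proof (rule good_star[where U = "{v, b1}" and w = "\<lambda>u. if u = v then y else r" and \<tau> = "\<lambda>_. 0"
        and s = 1 and ?y0.0 = b1 and ?y1.0 = b2 and ?y2.0 = v and ?y3.0 = p, OF bad_no_triangle[OF bad_a(1)]])
    have "v \<noteq> b1" using b xv by auto
    moreover have "y \<noteq> r" "y \<noteq> a1" "r \<noteq> a1" using yr yb a by auto
    ultimately show "\<And>u u'. u \<in> {v, b1} \<Longrightarrow> u' \<in> {v, b1} \<Longrightarrow> u \<noteq> u' \<Longrightarrow>
        (if u = v then y else r) \<noteq> (if u' = v then y else r)"
      "card ((\<lambda>_. 0 :: nat) ` {v, b1}) + 1 \<le> card {v, b1}"
      "\<And>u. u \<in> {v, b1} \<Longrightarrow> (if u = v then y else r) \<in> N u \<and> (if u = v then y else r) \<noteq> a1"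
      "\<And>u u'. u \<in> {v, b1} \<Longrightarrow> u' \<in> {v, b1} \<Longrightarrow> u \<noteq> u' \<Longrightarrow> 0 = 0 \<Longrightarrow>
        (if u = v then y else r) \<notin> N u' \<and> (if u = v then y else r) \<notin> N (if u' = v then y else r)"
      using yr vb yb vr yr' by auto
    show "distinct [b1, b2, v, p]" using b p xv by auto
  qed (use ab va p c0 c1 c2 c3 in auto)
  then show False using bad_a by blast
qed

subsection \<open>Four-cycles\<close>

lemma nonadj_sym: "y \<notin> N x \<Longrightarrow> x \<notin> N y"
  using sym by blast

text \<open>
  The edges of the four-cycle are coloured last. The pairs \<open>va\<close>, \<open>xb\<close> and \<open>u1c\<close>, \<open>u2d\<close> save two
  colours, and every edge of the cycle has degree at most 39, so one edge of degree 38 suffices.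
\<close>

lemma bad_cycle_card_Nb:
  assumes bad: "\<not> good v" and u: "u1 \<in> N v" "u2 \<in> N v" "u1 \<noteq> u2"
    and x: "x \<in> N u1" "x \<in> N u2" "x \<noteq> v"
  shows "39 \<le> card (Nb {v, u1})"
proof (rule ccontr)
  assume "\<not> 39 \<le> card (Nb {v, u1})"
  then have c0: "card (Nb {v, u1}) \<le> 36 + 2" by simp
  have u': "v \<in> N u1" "v \<in> N u2" "u1 \<in> N x" "u2 \<in> N x" using u x sym by blast+
  have bad_u: "\<not> good u1" "\<not> good u2" using bad_adj[OF bad] u by blast+
  have bad_x: "\<not> good x" using bad_adj[OF bad_u(1)] x by blast
  note no_tri = bad_no_triangle[OF bad] bad_no_triangle[OF bad_x]
    bad_no_triangle[OF bad_u(1)] bad_no_triangle[OF bad_u(2)]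
  have two: "2 \<le> card A" if "finite A" "{p, q} \<subseteq> A" "p \<noteq> q" for A and p q :: 'a
    using card_mono[OF that(1,2)] that(3) by simp
  have vx: "v \<noteq> x" using x by simp
  have "2 \<le> card (N v \<inter> N x)" using two[of "N v \<inter> N x" u1 u2] u u' by simp
  then obtain a b where "a \<in> N v - N x" "b \<in> N x - N v" "b \<notin> N a"
    by (rule bad_nonadjacent_pair[OF bad vx])
  then have ab: "a \<in> N v" "a \<notin> N x" "b \<in> N x" "b \<notin> N v" "b \<notin> N a" by auto
  have "2 \<le> card (N u1 \<inter> N u2)" using two[of "N u1 \<inter> N u2" v x] x u' by simp
  then obtain c d where "c \<in> N u1 - N u2" "d \<in> N u2 - N u1" "d \<notin> N c"
    by (rule bad_nonadjacent_pair[OF bad_u(1) u(3)])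
  then have cd: "c \<in> N u1" "c \<notin> N u2" "d \<in> N u2" "d \<notin> N u1" "d \<notin> N c" by auto
  have xv: "x \<notin> N v" "u2 \<notin> N u1" using no_tri u x by blast+
  have c1: "card (Nb {x, u1}) \<le> 39" "card (Nb {x, u2}) \<le> 39" "card (Nb {v, u2}) \<le> 39"
    using card_Nb_common[of u1 x v] card_Nb_common[of u2 x v] card_Nb_common[of u2 v x]
      \<open>2 \<le> card (N v \<inter> N x)\<close> vx u u' by (simp_all add: Int_commute)
  have odd: "v \<noteq> a" "v \<noteq> b" "v \<noteq> u1" "v \<noteq> u2" "x \<noteq> a" "x \<noteq> b" "x \<noteq> u1" "x \<noteq> u2"
    "c \<noteq> u1" "c \<noteq> u2" "d \<noteq> u1" "d \<noteq> u2"
    using ab cd u u' xv irrefl sym by blast+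
  have same: "a \<noteq> b" "a \<noteq> u1" "a \<noteq> u2" "b \<noteq> u1" "b \<noteq> u2"
    "c \<noteq> d" "c \<noteq> v" "c \<noteq> x" "d \<noteq> v" "d \<noteq> x"
    using ab cd u u' x sym by blast+
  \<comment> \<open>Any of these adjacencies would close a triangle at \<open>u1\<close> or
    \<open>u2\<close>.\<close>
  have cross: "c \<notin> N v" "d \<notin> N v" "c \<notin> N x" "d \<notin> N x"
    using no_tri cd u u' sym by blast+
  then have cross': "c \<noteq> a" "c \<noteq> b" "d \<noteq> a" "d \<noteq> b" using ab by blast+
  let ?S0 = "{{v, a}, {x, b}}" and ?S1 = "{{u1, c}, {u2, d}}"
  let ?F = "{{v, u1}, {v, u2}, {x, u1}, {x, u2}}"
  let ?\<sigma> = "\<lambda>e. if e \<in> ?S0 then 0 else (1 :: nat)"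
  note neq = odd odd[symmetric] same same[symmetric] cross' cross'[symmetric] u(3) u(3)[symmetric] vx vx[symmetric]
  have "v \<notin> N b" "x \<notin> N a" "b \<notin> N a" "a \<notin> N b" "v \<notin> N x" "u1 \<notin> N u2" "u1 \<notin> N d" "u2 \<notin> N c" "c \<notin> N d"
    using ab cd xv sym by blast+
  note nonadj = this ab(2,4) cd(2,4,5) xv
  have edges: "u1 \<in> N v" "u2 \<in> N v" "u1 \<in> N x" "u2 \<in> N x" "a \<in> N v" "b \<in> N x" "c \<in> N u1" "d \<in> N u2"
    using u u' ab cd by blast+
  have "good v"
  proof (rule good_root4[where S = "?S0 \<union> ?S1" and \<sigma> = ?\<sigma> and s = 2])
    show "?F \<subseteq> E" "?S0 \<union> ?S1 \<subseteq> E" using edges by simp_all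
    show "distinct [{v, u1}, {v, u2}, {x, u1}, {x, u2}]"
      using neq by (simp add: doubleton_eq_iff)
    show "conf e f" if "e \<in> ?F" "f \<in> ?F" "e \<noteq> f" for e f
      using that edges by (elim insertE emptyE) (simp_all add: conf_pair)
    show "(?S0 \<union> ?S1) \<inter> ?F = {}"
      using neq by (simp add: doubleton_eq_iff)
    show "e \<inter> f = {}" if "e \<in> ?S0 \<union> ?S1" "f \<in> ?S0 \<union> ?S1" "e \<noteq> f" for e f
      using that neq unfolding Un_insert_left Un_empty_left
      by (elim insertE emptyE) simp_all
    show "?\<sigma> e \<noteq> ?\<sigma> f" if "e \<in> ?S0 \<union> ?S1" "f \<in> ?S0 \<union> ?S1" "conf e f" for e f
      using that neq nonadj edges unfolding Un_insert_left Un_empty_left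
      by (elim insertE emptyE) (simp_all add: conf_pair doubleton_eq_iff)
    show "conf f e" if "e \<in> ?S0 \<union> ?S1" "f \<in> ?F" for e f
      using that neq edges u' x unfolding Un_insert_left Un_empty_left
      by (elim insertE emptyE) (simp_all add: conf_pair doubleton_eq_iff)
    have "card (?S0 \<union> ?S1) = 4" using neq by (simp add: card_insert_if doubleton_eq_iff)
    moreover have "card (?\<sigma> ` (?S0 \<union> ?S1)) \<le> card {0, 1 :: nat}" by (intro card_mono) auto
    ultimately show "card (?\<sigma> ` (?S0 \<union> ?S1)) + 2 \<le> card (?S0 \<union> ?S1)" by simp
    show "conf e f" if ef: "e \<in> inc v" "e \<notin> ?F" "f \<in> ?F" for e f
    proof -
      obtain y where y: "e = {v, y}" "y \<in> N v" using ef(1) by (auto simp: inc_eq)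
      then have "e \<noteq> f" using ef by blast
      then show ?thesis using ef(3) y edges by (elim insertE emptyE) (simp_all add: conf_pair)
    qed
  qed (use c0 c1 in auto)
  then show False using bad by blast
qed

text \<open>Two different four-cycles through \<open>vu\<close> have different edges opposite to it,
  because \<open>p\<close> is not adjacent to \<open>u\<close>; then \<open>vu\<close> would have
  degree at most 38.\<close>

lemma bad_cycle_unique:
  assumes bad: "\<not> good v" and u: "u \<in> N v"
    and p: "p \<in> N v" "p \<noteq> u" "x \<in> N u" "x \<in> N p" "x \<noteq> v"
    and q: "q \<in> N v" "q \<noteq> u" "y \<in> N u" "y \<in> N q" "y \<noteq> v"
  shows "p = q \<and> x = y"
proof (rule ccontr)
  assume ne: "\<not> (p = q \<and> x = y)"
  have "p \<notin> N u" using bad_no_triangle[OF bad u p(1)] .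
  then have "{p, x} \<noteq> {q, y}" using ne q by (auto simp: doubleton_eq_iff)
  then have "card {{p, x}, {q, y}} = 2" by simp
  moreover have "card (Nb {v, u}) + card {{p, x}, {q, y}} \<le> 40"
    using p q by (intro card_Nb_cycles[OF u]) blast
  moreover have "39 \<le> card (Nb {v, u})"
    using bad_cycle_card_Nb[OF bad u p(1)] p by auto
  ultimately show False by linarith
qed

text \<open>The private neighbours of \<open>u \<in> N v\<close>, reached from \<open>v\<close> only
  through \<open>u\<close>: no four-cycle has \<open>v\<close> and \<open>w\<close> as opposite
  corners.\<close>

definition priv :: "'a \<Rightarrow> 'a \<Rightarrow> 'a set" where
  "priv v u = {w \<in> N u. w \<noteq> v \<and> N w \<inter> N v = {u}}"

lemma privD: "w \<in> priv v u \<Longrightarrow> w \<in> N u" "w \<in> priv v u \<Longrightarrow> w \<noteq> v"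
  and priv_unique: "w \<in> priv v u \<Longrightarrow> y \<in> N v \<Longrightarrow> w \<in> N y \<Longrightarrow> y = u"
  using sym by (auto simp: priv_def)

text \<open>A neighbour of \<open>u\<close> other than \<open>v\<close> that is not private closes a
  four-cycle through \<open>vu\<close>, and there is at most one such cycle: 5 - 1 - 1 = 3.\<close>

lemma card_priv:
  assumes bad: "\<not> good v" and u: "u \<in> N v"
  shows "3 \<le> card (priv v u)"
proof -
  let ?R = "N u - {v} - priv v u"
  have vu: "v \<in> N u" using u sym by blast
  have other: "\<exists>p\<in>N v. p \<noteq> u \<and> w \<in> N p" if "w \<in> ?R" for w
    using that u sym unfolding priv_def by blast
  have "card ?R \<le> 1"
  proof (rule card_le_1_if_unique)
    fix x y assume xy: "x \<in> ?R" "y \<in> ?R"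
    then obtain p q where "p \<in> N v" "p \<noteq> u" "x \<in> N p" "q \<in> N v" "q \<noteq> u" "y \<in> N q"
      using other by meson
    then show "x = y" using bad_cycle_unique[OF bad u] xy by blast
  qed
  moreover have "card (N u) = 5" using bad_degree bad_adj[OF bad u] by blast
  moreover have "card (N u - {v}) \<le> card ?R + card (priv v u)"
    by (intro order_trans[OF _ card_Un_le] card_mono) (auto simp: priv_def)
  ultimately show ?thesis using vu by simp
qed

text \<open>
  Every edge lies in at most one four-cycle. Three of the edges from neighbours \<open>u\<close> of \<open>v\<close> to private
  neighbours of \<open>u\<close> can get one colour and the other two a second one. This saves three colours, and
  the edge \<open>vu1\<close> of the four-cycle has degree at most 39.
\<close>

lemma bad_no_cycle:
  assumes bad: "\<not> good v" and u: "u1 \<in> N v" "u2 \<in> N v" "u1 \<noteq> u2"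
    and x: "x \<in> N u1" "x \<in> N u2"
  shows "x = v"
proof (rule ccontr)
  assume xv: "x \<noteq> v"
  have vu: "v \<in> N u" if "u \<in> N v" for u using that sym by blast
  have bad_u: "\<not> good u" if "u \<in> N v" for u using bad_adj[OF bad that] .
  have uniq: "p = q \<and> y = z" if "u \<in> N v" "t \<in> N u" "p \<in> N u" "p \<noteq> t" "y \<in> N t" "y \<in> N p" "y \<noteq> u"
      "q \<in> N u" "q \<noteq> t" "z \<in> N t" "z \<in> N q" "z \<noteq> u" for u t p q y z
    using bad_cycle_unique[OF bad_u[OF that(1)] that(2-)] .
  have "card (N v - {u1, u2}) = 3"
    using bad_degree[OF bad] u by (simp add: card_Diff_subset)
  then have "3 \<le> card (N v - {u1, u2})" by simp
  then obtain us where us: "distinct us" "set us \<subseteq> N v - {u1, u2}" "length us = 3"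
    by (rule ex_distinct_list)
  from us(3) obtain u3 u4 u5 where us': "us = [u3, u4, u5]"
    by (auto simp: length_Suc_conv eval_nat_numeral)
  have "distinct (u1 # u2 # us)" "set us \<subseteq> N v"
    using us(1,2) u(3) unfolding distinct.simps list.set insert_iff by blast+
  then have dist: "distinct [u1, u2, u3, u4, u5]" and u': "u3 \<in> N v" "u4 \<in> N v" "u5 \<in> N v"
    unfolding us' by simp_all
  \<comment> \<open>The vertex \<open>x\<close> is private to neither \<open>u1\<close> nor
    \<open>u2\<close>.\<close>
  have two_max: "card (priv v u) \<le> 3" if "u = u1 \<or> u = u2" for u
  proof -
    have "u1 \<in> N x \<inter> N v" "u2 \<in> N x \<inter> N v" using u x sym by blast+
    then have "N x \<inter> N v \<noteq> {u}" using u(3) by (metis singletonD)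
    then have "priv v u \<subseteq> N u - {v, x}" unfolding priv_def by blast
    moreover have "u \<in> N v" "x \<in> N u" using that u(1,2) x by blast+
    then have "card (N u - {v, x}) \<le> 3"
      using xv vu[of u] card_N[of u] by (simp add: card_Diff_subset)
    ultimately show ?thesis by (meson card_mono finite_Diff finite_N le_trans)
  qed
  \<comment> \<open>These choices at \<open>u5\<close> would exclude two or more choices at
    \<open>u\<close>. Two of them share a neighbour \<open>t\<close> in the at most three elements
    of \<open>priv v u\<close>, and then \<open>ut\<close> lies in two four-cycles. So
    \<open>u1\<close> and \<open>u2\<close> each rule out at most one of at least three candidates
    for \<open>w5\<close>.\<close>
  let ?D = "\<lambda>u. {w \<in> priv v u5. 2 \<le> card (priv v u \<inter> N w)}"
  have D: "card (?D u) \<le> 1" if "u = u1 \<or> u = u2" for u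
  proof (rule card_le_1_if_unique)
    fix w w' assume w: "w \<in> ?D u" "w' \<in> ?D u"
    have uN: "u \<in> N v" "u \<noteq> u5" using that u dist by auto
    have "priv v u \<inter> N w \<inter> N w' \<noteq> {}"
      using two_max[OF that] w by (intro common_of_two_pairs) (simp_all add: priv_def)
    then obtain t where t: "t \<in> priv v u" "t \<in> N w" "t \<in> N w'" by blast
    have "2 \<le> card (priv v u \<inter> N w)" "2 \<le> card (priv v u \<inter> N w')" using w by simp_all
    then obtain p q where p: "p \<in> priv v u \<inter> N w" "p \<noteq> t" and q: "q \<in> priv v u \<inter> N w'" "q \<noteq> t"
      by (meson two_elements)
    have "w \<noteq> u" "w' \<noteq> u"
      using w bad_no_triangle[OF bad u'(3) uN(1)] privD(1) by blast+
    moreover have "t \<in> N u" "p \<in> N u" "q \<in> N u" using t p q privD by blast+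
    moreover have "w \<in> N t" "w \<in> N p" "w' \<in> N t" "w' \<in> N q" using t p q sym by blast+
    ultimately show "w = w'" using uniq[OF uN(1), of t p w q w'] p(2) q(2) by blast
  qed
  have "card (?D u1 \<union> ?D u2) \<le> 2"
    using D[of u1] D[of u2] card_Un_le[of "?D u1" "?D u2"] by simp
  then have "\<not> priv v u5 \<subseteq> ?D u1 \<union> ?D u2"
    using card_priv[OF bad u'(3)] card_mono[of "?D u1 \<union> ?D u2" "priv v u5"]
    by (auto simp: priv_def)
  then obtain w5 where w5: "w5 \<in> priv v u5" "card (priv v u1 \<inter> N w5) \<le> 1" "card (priv v u2 \<inter> N w5) \<le> 1"
    by force
  have fin: "finite (priv v u)" for u by (simp add: priv_def)
  have left: "2 \<le> card (priv v u - N w5)" if "u \<in> N v" "card (priv v u \<inter> N w5) \<le> 1" for u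
    using card_priv[OF bad that(1)] that(2) card_Int_Diff[OF fin, of u "N w5"] by linarith
  \<comment> \<open>At least two choices remain at each of \<open>u1\<close> and \<open>u2\<close>.
    If all were adjacent across, \<open>u1t\<close> would lie in the four-cycles
    \<open>u1 t y p\<close> and \<open>u1 t z p\<close>.\<close>
  obtain w1 w2 where w12: "w1 \<in> priv v u1 - N w5" "w2 \<in> priv v u2 - N w5" "w2 \<notin> N w1"
  proof (rule ccontr)
    assume "\<not> thesis"
    with that have complete: "w2 \<in> N w1" if "w1 \<in> priv v u1 - N w5" "w2 \<in> priv v u2 - N w5" for w1 w2
      using that by blast
    obtain t where t: "t \<in> priv v u1 - N w5"
      using two_elements[OF left[OF u(1) w5(2)]] by blast
    obtain p where p: "p \<in> priv v u1 - N w5" "p \<noteq> t"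
      using two_elements[OF left[OF u(1) w5(2)]] by blast
    obtain y where y: "y \<in> priv v u2 - N w5"
      using two_elements[OF left[OF u(2) w5(3)]] by blast
    obtain z where z: "z \<in> priv v u2 - N w5" "z \<noteq> y"
      using two_elements[OF left[OF u(2) w5(3)]] by blast
    have "y \<noteq> u1" "z \<noteq> u1" using y z bad_no_triangle[OF bad u(2) u(1)] privD(1) by blast+
    moreover have "t \<in> N u1" "p \<in> N u1" using t p privD by blast+
    moreover have "y \<in> N t" "y \<in> N p" "z \<in> N t" "z \<in> N p" using t p(1) y z(1) complete by blast+
    ultimately show False using uniq[OF u(1), of t p y p z] p(2) z(2) by blast
  qed
  have "priv v u3 \<noteq> {}" using card_priv[OF bad u'(1)] by auto
  then obtain w3 where w3: "w3 \<in> priv v u3" by blast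
  \<comment> \<open>Otherwise \<open>u4t\<close> would lie in the four-cycles
    \<open>u4 t w3 p\<close> and \<open>u4 t w3 q\<close>.\<close>
  have "\<not> priv v u4 \<subseteq> N w3"
  proof
    assume sub: "priv v u4 \<subseteq> N w3"
    obtain ws where ws: "distinct ws" "set ws \<subseteq> priv v u4" "length ws = 3"
      using card_priv[OF bad u'(2)] by (rule ex_distinct_list)
    from ws(3) obtain t p q where "ws = [t, p, q]"
      by (auto simp: length_Suc_conv eval_nat_numeral)
    with ws have tpq: "t \<in> priv v u4" "p \<in> priv v u4" "q \<in> priv v u4" "t \<noteq> p" "t \<noteq> q" "p \<noteq> q" by auto
    have "w3 \<noteq> u4" using w3 bad_no_triangle[OF bad u'(1,2)] privD(1) by blast
    moreover have "t \<in> N u4" "p \<in> N u4" "q \<in> N u4" using tpq(1-3) privD by blast+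
    moreover have "w3 \<in> N t" "w3 \<in> N p" "w3 \<in> N q" using tpq(1-3) sub sym by blast+
    ultimately show False using uniq[OF u'(2), of t p w3 q w3] tpq(4-6) by blast
  qed
  then obtain w4 where w4: "w4 \<in> priv v u4" "w4 \<notin> N w3" by blast
  have neq: "u1 \<noteq> u2" "u1 \<noteq> u3" "u1 \<noteq> u4" "u1 \<noteq> u5" "u2 \<noteq> u3" "u2 \<noteq> u4" "u2 \<noteq> u5"
    "u3 \<noteq> u4" "u3 \<noteq> u5" "u4 \<noteq> u5"
    using dist by simp_all
  define w where "w u = (if u = u1 then w1 else if u = u2 then w2 else if u = u3 then w3
    else if u = u4 then w4 else w5)" for u
  have w_simps [simp]: "w u1 = w1" "w u2 = w2" "w u3 = w3" "w u4 = w4" "w u5 = w5"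
    using dist unfolding w_def by auto
  \<comment> \<open>Colour 0 belongs to the pairwise nonadjacent \<open>w1\<close>,
    \<open>w2\<close>, \<open>w5\<close> and colour 1 to \<open>w3\<close>, \<open>w4\<close>: five
    edges with two colours, hence \<open>s = 3\<close>.\<close>
  let ?U = "{u1, u2, u3, u4, u5}" and ?\<tau> = "\<lambda>u. if u \<in> {u3, u4} then 1 else (0 :: nat)"
  have w_priv: "w u \<in> priv v u" if "u \<in> ?U" for u
    using that w12 w3 w4 w5 by auto
  have UN: "?U \<subseteq> N v" using u u' by auto
  have "good v"
  proof (rule good_star[where U = ?U and w = w and \<tau> = ?\<tau> and s = 3, OF bad_no_triangle[OF bad]])
    show "distinct [u1, u2, u3, u4]" "{u1, u2, u3, u4} \<subseteq> N v" using dist u u' by auto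
    show "w u \<in> N u \<and> w u \<noteq> v" if "u \<in> ?U" for u
      using w_priv[OF that] by (simp add: priv_def)
    show "w u \<noteq> w u'" if "u \<in> ?U" "u' \<in> ?U" "u \<noteq> u'" for u u'
    proof -
      have "u' \<in> N v" using that(2) UN by blast
      moreover have "w u' \<in> N u'" using w_priv[OF that(2)] by (rule privD)
      ultimately show ?thesis using priv_unique[OF w_priv[OF that(1)], of u'] that(3) by metis
    qed
    show "w u \<notin> N u' \<and> w u \<notin> N (w u')" if uu: "u \<in> ?U" "u' \<in> ?U" "u \<noteq> u'" "?\<tau> u = ?\<tau> u'" for u u'
    proof
      show "w u \<notin> N u'"
        using priv_unique[OF w_priv[OF uu(1)], of u'] uu(2,3) UN by blast
      have nonadj: "w2 \<notin> N w1" "w1 \<notin> N w5" "w2 \<notin> N w5" "w4 \<notin> N w3"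
        using w12 w4(2) by simp_all
      note sep = nonadj nonadj[THEN nonadj_sym] irrefl neq neq[symmetric]
      from uu(1) show "w u \<notin> N (w u')"
      proof (elim insertE emptyE)
        assume u: "u = u1"
        from uu(2-4) show ?thesis unfolding u by (elim insertE emptyE) (simp_all add: sep)
      next
        assume u: "u = u2"
        from uu(2-4) show ?thesis unfolding u by (elim insertE emptyE) (simp_all add: sep)
      next
        assume u: "u = u3"
        from uu(2-4) show ?thesis unfolding u by (elim insertE emptyE) (simp_all add: sep)
      next
        assume u: "u = u4"
        from uu(2-4) show ?thesis unfolding u by (elim insertE emptyE) (simp_all add: sep)
      next
        assume u: "u = u5"
        from uu(2-4) show ?thesis unfolding u by (elim insertE emptyE) (simp_all add: sep)
      qed
    qed
    have "?\<tau> ` ?U = {0, 1}" using dist by auto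
    moreover have "card ?U = 5" using dist by simp
    ultimately show "card (?\<tau> ` ?U) + 3 \<le> card ?U" by simp
    have "u1 \<in> N x" using x sym by blast
    moreover have "2 \<le> card (N v \<inter> N x)"
      using card_mono[of "N v \<inter> N x" "{u1, u2}"] u x sym by simp
    ultimately show "card (Nb {v, u1}) \<le> 36 + 3"
      using card_Nb_common[of u1 v x] u xv by simp
    show "card (Nb {v, u2}) \<le> 37 + 3" "card (Nb {v, u3}) \<le> 38 + 3" "card (Nb {v, u4}) \<le> 39 + 3"
      using card_Nb[of "{v, u2}"] card_Nb[of "{v, u3}"] card_Nb[of "{v, u4}"] u u' by simp_all
  qed (use UN in auto)
  then show False using bad by blast
qed

subsection \<open>The case without four-cycles\<close>

text \<open>An independent transversal of the second layer around \<open>v\<close>. Distinctness of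
  the chosen vertices comes later, from the absence of four-cycles.\<close>

definition transversal :: "'a \<Rightarrow> ('a \<Rightarrow> 'a) \<Rightarrow> bool" where
  "transversal v w \<longleftrightarrow> (\<forall>u\<in>N v. w u \<in> N u - {v}) \<and>
     (\<forall>u\<in>N v. \<forall>u'\<in>N v. u \<noteq> u' \<longrightarrow> w u \<notin> N (w u'))"

lemma transversalI:
  assumes bad: "\<not> good v" and dist: "distinct [u1, u2, u3, u4, u5]" and sub: "{u1, u2, u3, u4, u5} \<subseteq> N v"
    and w: "w1 \<in> N u1 - {v}" "w2 \<in> N u2 - {v}" "w3 \<in> N u3 - {v}" "w4 \<in> N u4 - {v}" "w5 \<in> N u5 - {v}"
    and nonadj: "w2 \<notin> N w1" "w3 \<notin> N w1" "w4 \<notin> N w1" "w5 \<notin> N w1" "w3 \<notin> N w2" "w4 \<notin> N w2"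
      "w5 \<notin> N w2" "w4 \<notin> N w3" "w5 \<notin> N w3" "w5 \<notin> N w4"
  shows "\<exists>w. transversal v w"
proof -
  have "card {u1, u2, u3, u4, u5} = 5" using dist by simp
  then have Nv: "N v = {u1, u2, u3, u4, u5}"
    using sub bad_degree[OF bad] by (intro card_seteq[symmetric]) auto
  define w where "w u = (if u = u1 then w1 else if u = u2 then w2 else if u = u3 then w3
    else if u = u4 then w4 else w5)" for u
  have w_simps: "w u1 = w1" "w u2 = w2" "w u3 = w3" "w u4 = w4" "w u5 = w5"
    using dist unfolding w_def by auto
  note sep = nonadj nonadj[THEN nonadj_sym]
  have "\<forall>u\<in>N v. w u \<in> N u - {v}"
    unfolding Nv using w by (simp add: w_simps)
  moreover have "\<forall>u\<in>N v. \<forall>u'\<in>N v. u \<noteq> u' \<longrightarrow> w u \<notin> N (w u')"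
    unfolding Nv ball_simps w_simps by (simp add: sep)
  ultimately show ?thesis unfolding transversal_def by blast
qed

lemma pick_nonadjacent:
  assumes "finite Z" "\<And>z. z \<in> Z \<Longrightarrow> card (N z \<inter> X) \<le> 1" "card Z < card X"
  shows "\<exists>w\<in>X. \<forall>z\<in>Z. w \<notin> N z"
proof -
  have "card (\<Union>z\<in>Z. N z \<inter> X) \<le> (\<Sum>z\<in>Z. 1)"
    by (intro order_trans[OF card_UN_le[OF assms(1)]] sum_mono assms(2))
  then have "\<not> X \<subseteq> (\<Union>z\<in>Z. N z \<inter> X)"
    using assms card_mono[of "\<Union>z\<in>Z. N z \<inter> X" X] by auto
  then show ?thesis by blast
qed

text \<open>Two neighbours of \<open>z\<close> beyond \<open>u\<close> would close a four-cycle
  through \<open>u\<close> and \<open>z\<close>. So the edges between two branches form a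
  matching.\<close>

lemma bad_matching:
  assumes bad: "\<not> good v" and "u \<in> N v" "u' \<in> N v" "u \<noteq> u'" "z \<in> N u' - {v}"
  shows "card (N z \<inter> (N u - {v})) \<le> 1"
proof (rule card_le_1_if_unique)
  fix s t assume st: "s \<in> N z \<inter> (N u - {v})" "t \<in> N z \<inter> (N u - {v})"
  have "z \<noteq> u" using bad_no_triangle[OF bad assms(3,2)] assms(5) by blast
  moreover have "z \<in> N s" "z \<in> N t" using st sym by blast+
  ultimately show "s = t" using bad_no_cycle[OF bad_adj[OF bad assms(2)], of s t z] st by blast
qed

lemma bad_card_branch:
  assumes "\<not> good v" "u \<in> N v"
  shows "card (N u - {v}) = 4"
proof -
  have "v \<in> N u" using assms(2) by (rule sym)
  then show ?thesis using bad_degree[OF bad_adj[OF assms]] by simp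
qed

text \<open>
  As \<open>a\<close> excludes nothing at \<open>s\<close>, the choice at \<open>s\<close> can be made last: each of the four vertices there
  has to avoid only three others, each of which excludes at most one.
\<close>

lemma transversal_if_unmatched:
  assumes bad: "\<not> good v" and dist: "distinct [u, s, p, q, r]" and sub: "{u, s, p, q, r} \<subseteq> N v"
    and a: "a \<in> N u - {v}" "N a \<inter> (N s - {v}) = {}"
  shows "\<exists>w. transversal v w"
proof -
  note match = bad_matching[OF bad]
  have pick: "\<exists>w\<in>N t - {v}. w \<notin> N x \<and> w \<notin> N y \<and> w \<notin> N z"
    if t: "t \<in> N v" and le: "card (N x \<inter> (N t - {v})) \<le> 1" "card (N y \<inter> (N t - {v})) \<le> 1"
      "card (N z \<inter> (N t - {v})) \<le> 1" for t x y z
  proof -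
    have "card {x, y, z} \<le> 3" by (simp add: card_insert_if)
    then have "\<exists>w\<in>N t - {v}. \<forall>z\<in>{x, y, z}. w \<notin> N z"
      using bad_card_branch[OF bad t] le by (intro pick_nonadjacent) auto
    then show ?thesis by simp
  qed
  have N: "u \<in> N v" "s \<in> N v" "p \<in> N v" "q \<in> N v" "r \<in> N v" using sub by auto
  have neq: "s \<noteq> p" "s \<noteq> q" "s \<noteq> r" "p \<noteq> u" "q \<noteq> u" "q \<noteq> p" "r \<noteq> u" "r \<noteq> p" "r \<noteq> q"
    using dist by auto
  obtain w3 where w3: "w3 \<in> N p - {v}" "w3 \<notin> N a"
    using pick[of p a a a] match[OF N(3,1) neq(4) a(1)] N(3) by blast
  obtain w4 where w4: "w4 \<in> N q - {v}" "w4 \<notin> N a" "w4 \<notin> N w3"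
    using pick[of q a w3 w3] match[OF N(4,1) neq(5) a(1)] match[OF N(4,3) neq(6) w3(1)] N(4) by blast
  obtain w5 where w5: "w5 \<in> N r - {v}" "w5 \<notin> N a" "w5 \<notin> N w3" "w5 \<notin> N w4"
    using pick[of r a w3 w4] match[OF N(5,1) neq(7) a(1)] match[OF N(5,3) neq(8) w3(1)]
      match[OF N(5,4) neq(9) w4(1)] N(5) by blast
  obtain w2 where w2: "w2 \<in> N s - {v}" "w2 \<notin> N w3" "w2 \<notin> N w4" "w2 \<notin> N w5"
    using pick[of s w3 w4 w5] match[OF N(2,3) neq(1) w3(1)] match[OF N(2,4) neq(2) w4(1)]
      match[OF N(2,5) neq(3) w5(1)] N(2) by blast
  have "w2 \<notin> N a" using a(2) w2(1) by blast
  then show ?thesis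
    by (rule transversalI[OF bad dist sub a(1) w2(1) w3(1) w4(1) w5(1)])
      (fact w3 w4 w5 w2(2-4)[THEN nonadj_sym] \<open>w2 \<notin> N a\<close>)+
qed

text \<open>If \<open>a\<close> has neighbours \<open>b\<close> and \<open>c\<close> in the branches
  at \<open>u2\<close> and \<open>u3\<close>, these are nonadjacent, and in the branch at
  \<open>u1\<close> each of them excludes only \<open>a\<close>. Choosing \<open>b\<close>,
  \<open>c\<close>, then \<open>w4\<close> and \<open>w5\<close>, leaves three candidates other than
  \<open>a\<close> at \<open>u1\<close>, of which \<open>w4\<close> and \<open>w5\<close> exclude at
  most two.\<close>

lemma bad_transversal:
  assumes bad: "\<not> good v" and dist: "distinct [u1, u2, u3, u4, u5]" and sub: "{u1, u2, u3, u4, u5} \<subseteq> N v"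
  shows "\<exists>w. transversal v w"
proof -
  have N: "u1 \<in> N v" "u2 \<in> N v" "u3 \<in> N v" "u4 \<in> N v" "u5 \<in> N v" using sub by auto
  have neq: "u1 \<noteq> u2" "u1 \<noteq> u3" "u1 \<noteq> u4" "u1 \<noteq> u5" "u2 \<noteq> u3" "u2 \<noteq> u4" "u2 \<noteq> u5"
    "u3 \<noteq> u4" "u3 \<noteq> u5" "u4 \<noteq> u5"
    using dist by simp_all
  note match = bad_matching[OF bad]
  have "N u1 - {v} \<noteq> {}" using bad_card_branch[OF bad N(1)] by (metis card.empty zero_neq_numeral)
  then obtain a where a: "a \<in> N u1 - {v}" by blast
  consider "N a \<inter> (N u2 - {v}) = {}" | "N a \<inter> (N u3 - {v}) = {}"
    | b c where "b \<in> N a" "b \<in> N u2 - {v}" "c \<in> N a" "c \<in> N u3 - {v}" by blast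
  then show ?thesis
  proof cases
    case 1
    then show ?thesis by (rule transversal_if_unmatched[OF bad dist sub a])
  next
    case 2
    have "distinct [u1, u3, u2, u4, u5]" "{u1, u3, u2, u4, u5} \<subseteq> N v" using dist sub by auto
    from transversal_if_unmatched[OF bad this a 2] show ?thesis .
  next
    case (3 b c)
    have "\<not> good a" using bad_adj[OF bad_adj[OF bad N(1)], of a] a by blast
    then have cb: "c \<notin> N b" using bad_no_triangle 3(1,3) by blast
    have "\<exists>w\<in>N u4 - {v}. \<forall>z\<in>{b, c}. w \<notin> N z"
    proof (rule pick_nonadjacent)
      show "card (N z \<inter> (N u4 - {v})) \<le> 1" if "z \<in> {b, c}" for z
        using that match[OF N(4,2) neq(6)[symmetric] 3(2)] match[OF N(4,3) neq(8)[symmetric] 3(4)] by blast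
      show "card {b, c} < card (N u4 - {v})"
        using bad_card_branch[OF bad N(4)] by (simp add: card_insert_if)
    qed simp
    then obtain w4 where w4: "w4 \<in> N u4 - {v}" "w4 \<notin> N b" "w4 \<notin> N c" by blast
    have "\<exists>w\<in>N u5 - {v}. \<forall>z\<in>{b, c, w4}. w \<notin> N z"
    proof (rule pick_nonadjacent)
      show "card (N z \<inter> (N u5 - {v})) \<le> 1" if "z \<in> {b, c, w4}" for z
        using that match[OF N(5,2) neq(7)[symmetric] 3(2)] match[OF N(5,3) neq(9)[symmetric] 3(4)]
          match[OF N(5,4) neq(10)[symmetric] w4(1)] by blast
      show "card {b, c, w4} < card (N u5 - {v})"
        using bad_card_branch[OF bad N(5)] by (simp add: card_insert_if)
    qed simp
    then obtain w5 where w5: "w5 \<in> N u5 - {v}" "w5 \<notin> N b" "w5 \<notin> N c" "w5 \<notin> N w4" by blast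
    have "\<exists>w\<in>N u1 - {v} - {a}. \<forall>z\<in>{w4, w5}. w \<notin> N z"
    proof (rule pick_nonadjacent)
      show "card (N z \<inter> (N u1 - {v} - {a})) \<le> 1" if "z \<in> {w4, w5}" for z
      proof -
        have "card (N z \<inter> (N u1 - {v})) \<le> 1"
          using that match[OF N(1,4) neq(3) w4(1)] match[OF N(1,5) neq(4) w5(1)] by blast
        moreover have "card (N z \<inter> (N u1 - {v} - {a})) \<le> card (N z \<inter> (N u1 - {v}))"
          by (intro card_mono) auto
        ultimately show ?thesis by linarith
      qed
      show "card {w4, w5} < card (N u1 - {v} - {a})"
        using bad_card_branch[OF bad N(1)] a by (simp add: card_insert_if)
    qed simp
    then obtain w1 where w1: "w1 \<in> N u1 - {v}" "w1 \<noteq> a" "w1 \<notin> N w4" "w1 \<notin> N w5" by blast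
    have a_only: "w1 \<notin> N z" if "z \<in> N u' - {v}" "u' \<in> N v" "u1 \<noteq> u'" "z \<in> N a" for z u'
    proof
      assume "w1 \<in> N z"
      moreover have "a \<in> N z" using that(4) by (rule sym)
      ultimately have "{a, w1} \<subseteq> N z \<inter> (N u1 - {v})" using a w1(1) by blast
      then have "card {a, w1} \<le> card (N z \<inter> (N u1 - {v}))" by (intro card_mono) auto
      then show False using match[OF N(1) that(2,3,1)] w1(2) by simp
    qed
    have "w1 \<notin> N b" "w1 \<notin> N c"
      using a_only[OF 3(2) N(2) neq(1) 3(1)] a_only[OF 3(4) N(3) neq(2) 3(3)] .
    note w1b = this[THEN nonadj_sym]
    show ?thesis
      by (rule transversalI[OF bad dist sub w1(1) 3(2,4) w4(1) w5(1)])
        (fact w1b w1(3,4)[THEN nonadj_sym] cb w4 w5)+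
  qed
qed

text \<open>Each edge at \<open>v\<close> sees five edges of one colour, so even degree 40 leaves at
  most 40 - 4 = 36 colours.\<close>

lemma all_good: "good v"
proof (rule ccontr)
  assume bad: "\<not> good v"
  have "5 \<le> card (N v)" using bad_degree[OF bad] by simp
  then obtain us where us: "distinct us" "set us \<subseteq> N v" "length us = 5"
    by (rule ex_distinct_list)
  from us(3) obtain u1 u2 u3 u4 u5 where us': "us = [u1, u2, u3, u4, u5]"
    by (auto simp: length_Suc_conv eval_nat_numeral)
  have u: "distinct [u1, u2, u3, u4, u5]" "{u1, u2, u3, u4, u5} \<subseteq> N v"
    using us(1,2) unfolding us' by simp_all
  obtain w where w: "transversal v w" using bad_transversal[OF bad u] by blast
  have wN: "w u \<in> N u" "w u \<noteq> v" if "u \<in> N v" for u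
    using w that unfolding transversal_def by blast+
  have foreign: "w u \<notin> N u'" if "u \<in> N v" "u' \<in> N v" "u \<noteq> u'" for u u'
    using bad_no_cycle[OF bad that, of "w u"] wN[OF that(1)] by blast
  have "good v"
  proof (rule good_star[where U = "N v" and w = w and \<tau> = "\<lambda>_. 0" and s = 4, OF bad_no_triangle[OF bad]])
    show "distinct [u1, u2, u3, u4]" "{u1, u2, u3, u4} \<subseteq> N v" using u by simp_all
    show "w u \<noteq> w u'" if "u \<in> N v" "u' \<in> N v" "u \<noteq> u'" for u u'
      using foreign[OF that] wN(1)[OF that(2)] by metis
    show "w u \<notin> N u' \<and> w u \<notin> N (w u')" if "u \<in> N v" "u' \<in> N v" "u \<noteq> u'" for u u'
      using foreign[OF that] w that unfolding transversal_def by blast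
    have "(\<lambda>_. 0 :: nat) ` N v \<subseteq> {0}" by auto
    then have "card ((\<lambda>_. 0 :: nat) ` N v) \<le> card {0 :: nat}" by (intro card_mono) auto
    then show "card ((\<lambda>_. 0 :: nat) ` N v) + 4 \<le> card (N v)" using bad_degree[OF bad] by simp
    show "card (Nb {v, u1}) \<le> 36 + 4" "card (Nb {v, u2}) \<le> 37 + 4"
      "card (Nb {v, u3}) \<le> 38 + 4" "card (Nb {v, u4}) \<le> 39 + 4"
      using card_Nb[of "{v, u1}"] card_Nb[of "{v, u2}"] card_Nb[of "{v, u3}"] card_Nb[of "{v, u4}"] u(2)
      by simp_all
  qed (use wN in auto)
  then show False using bad by blast
qed

end

section \<open>Transfer to pair graphs\<close>

theorem theorem1p3:
  fixes G :: "'a pair_pre_digraph"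
  assumes "pair_graph G"
    and "max_degree G = 5"
  shows "\<exists>c :: 'a set \<Rightarrow> nat. strong_edge_coloring G c \<and> card (c ` uedges G) \<le> 37"
proof -
  interpret G: pair_graph G by fact
  define N where "N x = {y. (x, y) \<in> parcs G}" for x
  have sym: "x \<in> N y" if "y \<in> N x" for x y
    using that G.pair_sym_arcs by (auto simp: N_def dest: G.arcs_symmetric)
  have irrefl: "x \<notin> N x" for x
    using G.pair_no_loops[of "(x, x)"] by (auto simp: N_def)
  have "card (N x) = degree G x" for x
  proof -
    have "{e \<in> uedges G. x \<in> e} = (\<lambda>y. {x, y}) ` N x"
      using sym by (auto simp: uedges_def N_def insert_commute)
    moreover have "inj_on (\<lambda>y. {x, y}) (N x)" by (auto simp: inj_on_def doubleton_eq_iff)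
    ultimately show ?thesis by (simp add: degree_def card_image)
  qed
  moreover have "degree G x \<le> 5" if "x \<in> pverts G" for x
    using that assms(2) G.pair_finite_verts Max_ge[of "insert 0 (degree G ` pverts G)" "degree G x"]
    by (simp add: max_degree_def)
  \<comment> \<open>\<open>max_degree\<close> speaks about \<open>pverts G\<close> only, whereas the
    locale bounds the degree of every element of the type.\<close>
  moreover have "N x = {}" if "x \<notin> pverts G" for x
    using that G.in_arcsD1 by (auto simp: N_def)
  ultimately have "card (N x) \<le> 5" for x
    by (metis card.empty le0)
  then interpret deg5_graph N
    using sym irrefl G.pair_finite_arcs by unfold_locales (auto simp: N_def)
  have E_eq: "E = uedges G" by (simp add: E_def uedges_def N_def)
  have conf_iff: "conf e f \<longleftrightarrow> e \<noteq> f \<and> dist_le_two G e f" for e f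
    by (simp add: conf_def dist_le_two_def N_def)
  obtain c :: "'a set \<Rightarrow> nat" where c: "\<forall>e\<in>uedges G. c e < 37"
    "\<forall>e\<in>uedges G. \<forall>f\<in>uedges G. e \<noteq> f \<and> dist_le_two G e f \<longrightarrow> c e \<noteq> c f"
    using ex_colouring[OF all_good] unfolding E_eq conf_iff by blast
  have "card (c ` uedges G) \<le> card {..<37 :: nat}" using c(1) by (intro card_mono) auto
  then show ?thesis using c(2) by (auto simp: strong_edge_coloring_def)
qed

end
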